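(* Let $\mathcal{R}=\mathbb{C}[\partial]A\oplus\mathbb{C}[\partial]B$ be the direct sum of two Virasoro conformal algebras, let $V_{\delta,\alpha,\beta}=\mathbb{C}[\partial]v$ be a nontrivial finite irreducible $\mathcal{R}$-module and let $\eta\in\mathbb{C}$. Consider extensions of $\mathcal{R}$-modules of the form $$0\longrightarrow V_{\delta,\alpha,\beta}\longrightarrow E\longrightarrow \mathbb{C}c_{\eta}\longrightarrow 0 .\qquad(\ast)$$ Every such $E$ is, as a vector space, $\mathbb{C}[\partial]v\oplus\mathbb{C}c_\eta$ with $$A_\lambda v=\delta_1(\partial+\alpha_1\lambda+\beta_1)v,\quad B_\lambda v=\delta_2(\partial+\alpha_2\lambda+\beta_2)v,$$ $$A_\lambda c_\eta=f(\partial,\lambda)v,\quad B_\lambda c_\eta=g(\partial,\lambda)v,\quad \partial c_\eta=\eta c_\eta+h(\partial)v \qquad(\ast\ast)$$ for some $f(\partial,\lambda),g(\partial,\lambda)\in\mathbb{C}[\partial,\lambda]$, $h(\partial)\in\mathbb{C}[\partial]$. Nontrivial extensions of the form $(\ast)$ exist only when $\delta_1=1$, $\alpha_1=1$, $\beta_1+\eta=0$, or $\delta_2=1$, $\alpha_2=1$, $\beta_2+\eta=0$. In these cases there exists a unique (up to a scalar) nontrivial extension, i.e. $\dim\mathrm{Ext}(\mathbb{C}c_\eta,V_{\delta,\alpha,\beta})=1$. Moreover, the nontrivial extensions are given (up to equivalence) by $(\ast\ast)$ with the following data: (i) If $\delta_1=1$, $\alpha_1=1$, $\beta_1+\eta=0$,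 then $\delta_2=0$, $g(\partial,\lambda)=0$, $\alpha_2,\beta_2$ are arbitrary, and $f(\partial,\lambda)=h(\partial)=s$ with a nonzero constant $s$. (ii) If $\delta_2=1$, $\alpha_2=1$, $\beta_2+\eta=0$, then $\delta_1=0$, $f(\partial,\lambda)=0$, $\alpha_1,\beta_1$ are arbitrary, and $g(\partial,\lambda)=h(\partial)=t$ with a nonzero constant $t$.
   Context: Everything is over $\mathbb{C}$. A Lie conformal algebra $\mathcal{R}$ is a $\mathbb{C}[\partial]$-module with a $\mathbb{C}$-linear $\lambda$-bracket $\mathcal{R}\otimes\mathcal{R}\to\mathcal{R}[\lambda]$, $a\otimes b\mapsto[a_\lambda b]$, satisfying $[\partial a_\lambda b]=-\lambda[a_\lambda b]$, $[a_\lambda\partial b]=(\partial+\lambda)[a_\lambda b]$, $[a_\lambda b]=-[b_{-\lambda-\partial}a]$ and $[a_\lambda[b_\mu c]]=[[a_\lambda b]_{\lambda+\mu}c]+[b_\mu[a_\lambda c]]$. A conformal $\mathcal{R}$-module $V$ is a $\mathbb{C}[\partial]$-module with a $\mathbb{C}$-linear map $\mathcal{R}\otimes V\to V[\lambda]$, $a\otimes v\mapsto a_\lambda v$, satisfying $(\partial a)_\lambda v=-\lambda(a_\lambda v)$, $a_\lambda(\partial v)=(\partial+\lambda)a_\lambda v$, $a_\lambda(b_\mu v)=[a_\lambda b]_{\lambda+\mu}v+b_\mu(a_\lambda v)$. For $\eta\in\mathbb{C}$, $\mathbb{C}c_\eta$ is the one-dimensional module with $\partial c_\eta=\eta c_\eta$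 and $\mathcal{R}_\lambda c_\eta=0$. An extension of $W$ by $V$ is an exact sequence of modules $0\to V\to E\to W\to0$. Two extensions $E,E'$ are equivalent if there is a module homomorphism $E\to E'$ compatible with the identity maps of $V$ and $W$. An extension is trivial if it is equivalent to $V\oplus W$. $\mathrm{Ext}(W,V)$ is the vector space of extension cocycles modulo those equivalent to the trivial extension, and $\dim\mathrm{Ext}(W,V)$ is its dimension. The direct sum of two Virasoro conformal algebras has free basis $\{A,B\}$ over $\mathbb{C}[\partial]$ with $[A_\lambda A]=(\partial+2\lambda)A$, $[A_\lambda B]=0$, $[B_\lambda B]=(\partial+2\lambda)B$. Its nontrivial finite irreducible modules are $V_{\delta,\alpha,\beta}=\mathbb{C}[\partial]v$ (free of rank one) with $A_\lambda v=\delta_1(\partial+\alpha_1\lambda+\beta_1)v$, $B_\lambda v=\delta_2(\partial+\alpha_2\lambda+\beta_2)v$, where $\delta_i\in\{0,1\}$, $\delta_1^2+\delta_2^2=1$, $\beta_i\in\mathbb{C}$, $0\neq\alpha_i\in\mathbb{C}$ ($i=1,2$). *)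

theory Defs
  imports Complex_Main "HOL-Computational_Algebra.Polynomial"
    "HOL-Library.Product_Plus" "HOL-Library.Function_Algebras"
begin

text \<open>
  A \<open>\<complex>[\<partial>]\<close>-module is a \<^locale>\<open>module\<close> over the ring \<open>complex poly\<close>: the indeterminate
  \<open>[:0, 1:]\<close> is \<open>\<partial>\<close> and \<open>[:z:]\<close> is the scalar \<open>z\<close>.
  Iterated polynomial types render further indeterminates:

  \<open>\<complex>[\<partial>,\<lambda>]\<close> is \<open>complex poly poly\<close> (a polynomial in \<open>\<lambda>\<close> with coefficients in \<open>\<complex>[\<partial>]\<close>),
  \<open>\<complex>[\<partial>,\<lambda>,\<mu>]\<close> is \<open>complex poly poly poly\<close>, and for a \<open>\<complex>[\<partial>]\<close>-module \<open>V\<close> with elements of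
  type \<open>'v\<close>, \<open>V[\<lambda>]\<close> is \<open>'v poly\<close> and \<open>V[\<lambda>,\<mu>]\<close> is \<open>'v poly poly\<close>, the outermost
  indeterminate being \<open>\<mu>\<close>.
\<close>

text \<open>If \<open>V\<close> is a \<open>K\<close>-module with scalar multiplication \<open>s\<close>, then \<open>V[x]\<close> is a \<open>K[x]\<close>-module
  with scalar multiplication \<open>poly_scale s\<close>.\<close>

definition poly_scale ::
    "('k::comm_ring_1 \<Rightarrow> 'v::ab_group_add \<Rightarrow> 'v) \<Rightarrow> 'k poly \<Rightarrow> 'v poly \<Rightarrow> 'v poly" where
  "poly_scale s F p = (\<Sum>i\<le>degree F. \<Sum>j\<le>degree p. monom (s (coeff F i) (coeff p j)) (i + j))"

abbreviation del :: "complex poly" where "del \<equiv> [:0, 1:]"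

abbreviation del1 :: "complex poly poly" where "del1 \<equiv> [:del:]"
abbreviation lam1 :: "complex poly poly" where "lam1 \<equiv> [:0, 1:]"

abbreviation lam2 :: "complex poly poly poly" where "lam2 \<equiv> [:[:0, 1:]:]"
abbreviation mu2 :: "complex poly poly poly" where "mu2 \<equiv> [:0, 1:]"

text \<open>\<open>p(F)\<close> for \<open>p \<in> V[x]\<close>, as an element of \<open>V[\<lambda>]\<close> (for \<open>F \<in> \<complex>[\<partial>,\<lambda>]\<close>) or of \<open>V[\<lambda>,\<mu>]\<close>
  (for \<open>F \<in> \<complex>[\<partial>,\<lambda>,\<mu>]\<close>); powers of \<open>F\<close> act from the left on the coefficients of \<open>p\<close>.\<close>

definition subst1 ::
    "(complex poly \<Rightarrow> 'v::ab_group_add \<Rightarrow> 'v) \<Rightarrow> complex poly poly \<Rightarrow> 'v poly \<Rightarrow> 'v poly" where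
  "subst1 s F p = (\<Sum>j\<le>degree p. poly_scale s (F ^ j) [:coeff p j:])"

definition subst2 ::
    "(complex poly \<Rightarrow> 'v::ab_group_add \<Rightarrow> 'v) \<Rightarrow> complex poly poly poly \<Rightarrow> 'v poly \<Rightarrow> 'v poly poly"
  where
  "subst2 s F p = (\<Sum>j\<le>degree p. poly_scale (poly_scale s) (F ^ j) [:[:coeff p j:]:])"

text \<open>For \<open>p = \<Sum>\<^sub>j p\<^sub>j x\<^sup>j\<close> and \<open>\<phi>\<close> with values in \<open>V[y]\<close>, this is \<open>\<Sum>\<^sub>j G\<^sup>j \<phi>(p\<^sub>j)(F)\<close> in
  \<open>V[\<lambda>,\<mu>]\<close>. So \<open>a\<^sub>F (b\<^sub>G v)\<close> is \<open>nested s (act a) F (act b v) G\<close>, and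
  \<open>[a\<^sub>G b]\<^sub>F v\<close> is \<open>nested s (\<lambda>r. act r v) F [a\<^sub>x b] G\<close>.\<close>

definition nested ::
    "(complex poly \<Rightarrow> 'v::ab_group_add \<Rightarrow> 'v) \<Rightarrow> ('u::zero \<Rightarrow> 'v poly) \<Rightarrow> complex poly poly poly
      \<Rightarrow> 'u poly \<Rightarrow> complex poly poly poly \<Rightarrow> 'v poly poly" where
  "nested s \<phi> F p G =
    (\<Sum>j\<le>degree p. poly_scale (poly_scale s) (G ^ j) (subst2 s F (\<phi> (coeff p j))))"

text \<open>The axioms common to the \<open>\<lambda>\<close>-bracket of a Lie conformal algebra and to the
  \<open>\<lambda>\<close>-action on a conformal module: \<open>\<complex>\<close>-bilinearity, conformal sesquilinearity and
  the Jacobi identity.\<close>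

definition lambda_action ::
    "(complex poly \<Rightarrow> 'r::ab_group_add \<Rightarrow> 'r) \<Rightarrow> ('r \<Rightarrow> 'r \<Rightarrow> 'r poly)
      \<Rightarrow> (complex poly \<Rightarrow> 'v::ab_group_add \<Rightarrow> 'v) \<Rightarrow> ('r \<Rightarrow> 'v \<Rightarrow> 'v poly) \<Rightarrow> bool" where
  "lambda_action sR br s act \<longleftrightarrow>
    (\<forall>a b v. act (a + b) v = act a v + act b v) \<and>
    (\<forall>a v w. act a (v + w) = act a v + act a w) \<and>
    (\<forall>z a v. act (sR [:z:] a) v = poly_scale s [:[:z:]:] (act a v)) \<and>
    (\<forall>z a v. act a (s [:z:] v) = poly_scale s [:[:z:]:] (act a v)) \<and>
    (\<forall>a v. act (sR del a) v = poly_scale s (- lam1) (act a v)) \<and>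
    (\<forall>a v. act a (s del v) = poly_scale s (del1 + lam1) (act a v)) \<and>
    (\<forall>a b v. nested s (act a) lam2 (act b v) mu2 =
       nested s (\<lambda>r. act r v) (lam2 + mu2) (br a b) lam2 + nested s (act b) mu2 (act a v) lam2)"

record (overloaded) 'r lca =
  lscale :: "complex poly \<Rightarrow> 'r \<Rightarrow> 'r"
  bracket :: "'r \<Rightarrow> 'r \<Rightarrow> 'r poly"

definition lie_conformal_algebra :: "'r::ab_group_add lca \<Rightarrow> bool" where
  "lie_conformal_algebra R \<longleftrightarrow>
    module (lscale R) \<and>
    lambda_action (lscale R) (bracket R) (lscale R) (bracket R) \<and>
    (\<forall>a b. bracket R a b = - subst1 (lscale R) (- lam1 - del1) (bracket R b a))"

record (overloaded) ('r, 'v) cmod =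
  mscale :: "complex poly \<Rightarrow> 'v \<Rightarrow> 'v"
  act :: "'r \<Rightarrow> 'v \<Rightarrow> 'v poly"

definition conformal_module ::
    "'r::ab_group_add lca \<Rightarrow> ('r, 'v::ab_group_add) cmod \<Rightarrow> bool" where
  "conformal_module R V \<longleftrightarrow>
    lie_conformal_algebra R \<and> module (mscale V) \<and>
    lambda_action (lscale R) (bracket R) (mscale V) (act V)"

definition cmod_hom ::
    "('r, 'v::ab_group_add) cmod \<Rightarrow> ('r, 'w::ab_group_add) cmod \<Rightarrow> ('v \<Rightarrow> 'w) \<Rightarrow> bool" where
  "cmod_hom V W \<phi> \<longleftrightarrow>
    module_hom (mscale V) (mscale W) \<phi> \<and> (\<forall>a v. act W a (\<phi> v) = map_poly \<phi> (act V a v))"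

text \<open>\<open>0 \<rightarrow> V \<rightarrow> E \<rightarrow> W \<rightarrow> 0\<close> with maps \<open>i\<close> and \<open>p\<close>.\<close>

definition extension ::
    "'r::ab_group_add lca \<Rightarrow> ('r, 'v::ab_group_add) cmod \<Rightarrow> ('r, 'w::ab_group_add) cmod
      \<Rightarrow> ('r, 'e::ab_group_add) cmod \<Rightarrow> ('v \<Rightarrow> 'e) \<Rightarrow> ('e \<Rightarrow> 'w) \<Rightarrow> bool" where
  "extension R V W E i p \<longleftrightarrow>
    conformal_module R V \<and> conformal_module R W \<and> conformal_module R E \<and>
    cmod_hom V E i \<and> cmod_hom E W p \<and> inj i \<and> surj p \<and> range i = {e. p e = 0}"

definition equiv_ext ::
    "('r, 'e::ab_group_add) cmod \<Rightarrow> ('v \<Rightarrow> 'e) \<Rightarrow> ('e \<Rightarrow> 'w)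
      \<Rightarrow> ('r, 'f::ab_group_add) cmod \<Rightarrow> ('v \<Rightarrow> 'f) \<Rightarrow> ('f \<Rightarrow> 'w) \<Rightarrow> bool" where
  "equiv_ext E i p E' i' p' \<longleftrightarrow>
    (\<exists>\<phi>. cmod_hom E E' \<phi> \<and> (\<forall>v. \<phi> (i v) = i' v) \<and> (\<forall>e. p' (\<phi> e) = p e))"

definition direct_sum ::
    "('r, 'v::ab_group_add) cmod \<Rightarrow> ('r, 'w::ab_group_add) cmod \<Rightarrow> ('r, 'v \<times> 'w) cmod" where
  "direct_sum V W =
    \<lparr>mscale = (\<lambda>q x. (mscale V q (fst x), mscale W q (snd x))),
     act = (\<lambda>a x. map_poly (\<lambda>v. (v, 0)) (act V a (fst x)) + map_poly (\<lambda>w. (0, w)) (act W a (snd x)))\<rparr>"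

definition trivial_ext ::
    "('r, 'v::ab_group_add) cmod \<Rightarrow> ('r, 'w::ab_group_add) cmod
      \<Rightarrow> ('r, 'e::ab_group_add) cmod \<Rightarrow> ('v \<Rightarrow> 'e) \<Rightarrow> ('e \<Rightarrow> 'w) \<Rightarrow> bool" where
  "trivial_ext V W E i p \<longleftrightarrow> equiv_ext E i p (direct_sum V W) (\<lambda>v. (v, 0)) snd"

text \<open>A pair \<open>(h, f)\<close> defines on the vector space \<open>V \<oplus> W\<close> the structure
  \<open>\<partial>(v, w) = (\<partial>v + h(w), \<partial>w)\<close> and \<open>a\<^sub>\<lambda>(v, w) = (a\<^sub>\<lambda>v + f\<^sub>a(w), a\<^sub>\<lambda>w)\<close>;
  it is a cocycle if this is a conformal module. A polynomial \<open>q(\<partial>)\<close> acts by \<open>q\<close> evaluated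
  at the operator \<open>\<partial>\<close>.\<close>

type_synonym ('r, 'v, 'w) cochain = "('w \<Rightarrow> 'v) \<times> ('r \<Rightarrow> 'w \<Rightarrow> 'v poly)"

definition twisted_sum ::
    "('r, 'v::ab_group_add) cmod \<Rightarrow> ('r, 'w::ab_group_add) cmod \<Rightarrow> ('r, 'v, 'w) cochain
      \<Rightarrow> ('r, 'v \<times> 'w) cmod" where
  "twisted_sum V W u =
    \<lparr>mscale = (\<lambda>q x. \<Sum>j\<le>degree q. mscale (direct_sum V W) [:coeff q j:]
         (((\<lambda>(v, w). (mscale V del v + fst u w, mscale W del w)) ^^ j) x)),
     act = (\<lambda>a x. act (direct_sum V W) a x + map_poly (\<lambda>v. (v, 0)) (snd u a (snd x)))\<rparr>"

definition cocycles ::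
    "'r::ab_group_add lca \<Rightarrow> ('r, 'v::ab_group_add) cmod \<Rightarrow> ('r, 'w::ab_group_add) cmod
      \<Rightarrow> ('r, 'v, 'w) cochain set" where
  "cocycles R V W = {u. extension R V W (twisted_sum V W u) (\<lambda>v. (v, 0)) snd}"

definition trivial_cocycles ::
    "'r::ab_group_add lca \<Rightarrow> ('r, 'v::ab_group_add) cmod \<Rightarrow> ('r, 'w::ab_group_add) cmod
      \<Rightarrow> ('r, 'v, 'w) cochain set" where
  "trivial_cocycles R V W =
    {u \<in> cocycles R V W. trivial_ext V W (twisted_sum V W u) (\<lambda>v. (v, 0)) snd}"

definition cochain_scale ::
    "('r, 'v::ab_group_add) cmod \<Rightarrow> complex \<Rightarrow> ('r, 'v, 'w) cochain \<Rightarrow> ('r, 'v, 'w) cochain" where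
  "cochain_scale V z u =
    (\<lambda>w. mscale V [:z:] (fst u w), \<lambda>a w. poly_scale (mscale V) [:[:z:]:] (snd u a w))"

text \<open>\<open>Z / B\<close> is a quotient of vector spaces of dimension \<open>n\<close>: the classes of the elements
  of \<open>S\<close> are pairwise distinct and form a basis of it.\<close>

definition quotient_dim ::
    "('k::field \<Rightarrow> 'x::ab_group_add \<Rightarrow> 'x) \<Rightarrow> 'x set \<Rightarrow> 'x set \<Rightarrow> nat \<Rightarrow> bool" where
  "quotient_dim sc Z B n \<longleftrightarrow>
    vector_space sc \<and> module.subspace sc Z \<and> module.subspace sc B \<and> B \<subseteq> Z \<and>
    (\<exists>S. finite S \<and> card S = n \<and> S \<subseteq> Z \<and>
      (\<forall>k. (\<Sum>x\<in>S. sc (k x) x) \<in> B \<longrightarrow> (\<forall>x\<in>S. k x = 0)) \<and>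
      (\<forall>z\<in>Z. \<exists>k. z - (\<Sum>x\<in>S. sc (k x) x) \<in> B))"

text \<open>\<open>dim Ext(W, V) = n\<close>. Beware of the order of the arguments: \<open>V\<close> is the submodule.\<close>

definition ext_dim ::
    "'r::ab_group_add lca \<Rightarrow> ('r, 'w::ab_group_add) cmod \<Rightarrow> ('r, 'v::ab_group_add) cmod
      \<Rightarrow> nat \<Rightarrow> bool" where
  "ext_dim R W V n \<longleftrightarrow>
    quotient_dim (cochain_scale V) (cocycles R V W) (trivial_cocycles R V W) n"

text \<open>The module \<open>\<complex>c\<^sub>\<eta>\<close>, with \<open>c\<^sub>\<eta> = 1\<close>.\<close>

definition one_dim :: "complex \<Rightarrow> ('r, complex) cmod" where
  "one_dim \<eta> = \<lparr>mscale = (\<lambda>q z. poly q \<eta> * z), act = (\<lambda>a z. 0)\<rparr>"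

definition free_basis :: "(complex poly \<Rightarrow> 'v::ab_group_add \<Rightarrow> 'v) \<Rightarrow> 'v set \<Rightarrow> bool" where
  "free_basis s S \<longleftrightarrow> \<not> module.dependent s S \<and> module.span s S = UNIV"

definition two_virasoro :: "'r::ab_group_add lca \<Rightarrow> 'r \<Rightarrow> 'r \<Rightarrow> bool" where
  "two_virasoro R A B \<longleftrightarrow>
    lie_conformal_algebra R \<and> A \<noteq> B \<and> free_basis (lscale R) {A, B} \<and>
    bracket R A A = poly_scale (lscale R) (del1 + 2 * lam1) [:A:] \<and>
    bracket R A B = 0 \<and>
    bracket R B B = poly_scale (lscale R) (del1 + 2 * lam1) [:B:]"

abbreviation vir_poly :: "complex \<Rightarrow> complex \<Rightarrow> complex \<Rightarrow> complex poly poly" where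
  "vir_poly d \<alpha> \<beta> \<equiv> [:[:d:]:] * (del1 + [:[:\<alpha>:]:] * lam1 + [:[:\<beta>:]:])"

definition rank_one_irreducible ::
    "'r::ab_group_add lca \<Rightarrow> 'r \<Rightarrow> 'r \<Rightarrow> complex \<Rightarrow> complex \<Rightarrow> complex \<Rightarrow> complex \<Rightarrow> complex \<Rightarrow> complex
      \<Rightarrow> ('r, 'v::ab_group_add) cmod \<Rightarrow> 'v \<Rightarrow> bool" where
  "rank_one_irreducible R A B d1 d2 \<alpha>1 \<alpha>2 \<beta>1 \<beta>2 V v \<longleftrightarrow>
    d1 \<in> {0, 1} \<and> d2 \<in> {0, 1} \<and> d1\<^sup>2 + d2\<^sup>2 = 1 \<and> \<alpha>1 \<noteq> 0 \<and> \<alpha>2 \<noteq> 0 \<and>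
    conformal_module R V \<and> free_basis (mscale V) {v} \<and>
    act V A v = poly_scale (mscale V) (vir_poly d1 \<alpha>1 \<beta>1) [:v:] \<and>
    act V B v = poly_scale (mscale V) (vir_poly d2 \<alpha>2 \<beta>2) [:v:]"

text \<open>\<open>E = \<complex>[\<partial>]v \<oplus> \<complex>c\<close> as a vector space, where \<open>v\<close> is identified with its image \<open>v'\<close> in
  \<open>E\<close>, and the structure of \<open>E\<close> is given by the polynomials \<open>f\<close>, \<open>g\<close>, \<open>h\<close>.\<close>

definition standard_form ::
    "'r \<Rightarrow> 'r \<Rightarrow> complex \<Rightarrow> complex \<Rightarrow> complex \<Rightarrow> complex \<Rightarrow> complex \<Rightarrow> complex \<Rightarrow> complex
      \<Rightarrow> ('r, 'e::ab_group_add) cmod \<Rightarrow> 'e \<Rightarrow> 'e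
      \<Rightarrow> complex poly poly \<Rightarrow> complex poly poly \<Rightarrow> complex poly \<Rightarrow> bool" where
  "standard_form A B d1 d2 \<alpha>1 \<alpha>2 \<beta>1 \<beta>2 \<eta> E v' c f g h \<longleftrightarrow>
    bij (\<lambda>(q, z). mscale E q v' + mscale E [:z:] c) \<and>
    act E A v' = poly_scale (mscale E) (vir_poly d1 \<alpha>1 \<beta>1) [:v':] \<and>
    act E B v' = poly_scale (mscale E) (vir_poly d2 \<alpha>2 \<beta>2) [:v':] \<and>
    act E A c = poly_scale (mscale E) f [:v':] \<and>
    act E B c = poly_scale (mscale E) g [:v':] \<and>
    mscale E del c = mscale E [:\<eta>:] c + mscale E h v'"

end

theory Submission
  imports Defs
begin

text \<open>
  Let \<open>0 \<rightarrow> V \<rightarrow> E \<rightarrow> \<complex>c\<^sub>\<eta> \<rightarrow> 0\<close> be exact, choose a preimage \<open>c\<close> of \<open>c\<^sub>\<eta>\<close>, and put \<open>x = (\<partial> - \<eta>)c\<close>, which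
  lies in \<open>V\<close>.  Since \<open>\<R>\<close> acts by zero on \<open>\<complex>c\<^sub>\<eta>\<close>, also \<open>a\<^sub>\<lambda>c\<close> lies in \<open>V[\<lambda>]\<close>, and sesquilinearity
  reads
  \<open>(\<partial> + \<lambda> - \<eta>) a\<^sub>\<lambda>c = a\<^sub>\<lambda>((\<partial> - \<eta>)c) = a\<^sub>\<lambda>x\<close>.
  As \<open>V\<close> has no torsion, \<open>x\<close> determines the whole action on \<open>c\<close>: an extension is the same thing as
  an element \<open>x\<close> of \<open>V\<close> such that \<open>\<partial> + \<lambda> - \<eta>\<close> divides \<open>a\<^sub>\<lambda>x\<close> for all \<open>a\<close> in \<open>\<R>\<close>.

  Conversely every such \<open>x\<close> gives an extension, and no axiom has to be checked by computation:
  \<open>\<theta>(v, w) = (\<partial> - \<eta>)v + wx\<close> is a \<open>\<complex>[\<partial>]\<close>-linear map from \<open>E = V \<oplus> \<complex>c\<^sub>\<eta>\<close> to \<open>V\<close>, and the action on \<open>E\<close> is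
  \<open>a\<^sub>\<lambda>e = (\<partial> + \<lambda> - \<eta>)\<^sup>-\<^sup>1 a\<^sub>\<lambda>\<theta>(e)\<close>.  Every axiom for \<open>E\<close>, multiplied by \<open>\<partial> + \<lambda> - \<eta>\<close> or, for the Jacobi identity,
  by \<open>\<partial> + \<lambda> + \<mu> - \<eta>\<close>, becomes the same axiom for \<open>V\<close>, and the factor cancels
  (\<open>lambda_action_pullback\<close>, \<open>cocycles_eq\<close>).

  Another choice of \<open>c\<close> changes \<open>x\<close> by an element of \<open>(\<partial> - \<eta>)V\<close>, and the extension is trivial iff \<open>x\<close>
  is in \<open>(\<partial> - \<eta>)V\<close> (\<open>trivial_ext_iff_root\<close>).  For \<open>V = \<complex>[\<partial>]v\<close> the remainder of division by \<open>\<partial> - \<eta>\<close> is a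
  constant, so one may take \<open>x = tv\<close> with \<open>t\<close> a number, and the extension is nontrivial iff \<open>t \<noteq> 0\<close>.
  In that case \<open>\<partial> + \<lambda> - \<eta>\<close> divides \<open>A\<^sub>\<lambda>v\<close> and \<open>B\<^sub>\<lambda>v\<close>.  One of these is zero, and \<open>\<partial> + \<lambda> - \<eta>\<close> divides the other
  one, \<open>(\<partial> + \<alpha>\<lambda> + \<beta>)v\<close>, only if \<open>\<alpha> = 1\<close> and \<open>\<beta> = -\<eta>\<close>; the quotient is then \<open>v\<close>, so the generator that acts
  nontrivially on \<open>v\<close> sends \<open>c\<close> to \<open>tv\<close>.  Under this condition \<open>\<partial> + \<lambda> - \<eta>\<close> divides \<open>a\<^sub>\<lambda>x\<close> for all \<open>a\<close> and
  \<open>x\<close>, and \<open>Ext(\<complex>c\<^sub>\<eta>, V) = V/(\<partial> - \<eta>)V\<close> has dimension one (\<open>ext_dim_one\<close>).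
\<close>

section \<open>Polynomials over a module\<close>

text \<open>The Cauchy product no longer mentions degrees, which makes identities between values of
  \<^const>\<open>poly_scale\<close> provable coefficient by coefficient.\<close>

lemma coeff_poly_scale:
  assumes "module s"
  shows "coeff (poly_scale s F p) n = (\<Sum>i\<le>n. s (coeff F i) (coeff p (n - i)))"
proof -
  interpret module s by fact
  have inner: "(\<Sum>j\<le>degree p. if i + j = n then s (coeff F i) (coeff p j) else 0) =
      (if i \<le> n then s (coeff F i) (coeff p (n - i)) else 0)" for i
  proof (cases "i \<le> n")
    case True
    have "(\<Sum>j\<le>degree p. if i + j = n then s (coeff F i) (coeff p j) else 0) =
        (\<Sum>j\<le>degree p. if n - i = j then s (coeff F i) (coeff p j) else 0)"
      using True by (intro sum.cong) auto
    also have "\<dots> = s (coeff F i) (coeff p (n - i))"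
      by (auto simp: sum.delta' coeff_eq_0)
    finally show ?thesis using True by simp
  qed auto
  have "coeff (poly_scale s F p) n =
      (\<Sum>i\<le>degree F. if i \<le> n then s (coeff F i) (coeff p (n - i)) else 0)"
    unfolding inner[symmetric] by (simp add: poly_scale_def coeff_sum coeff_monom if_distrib)
  also have "\<dots> = (\<Sum>i\<in>{..degree F} \<inter> {..n}. s (coeff F i) (coeff p (n - i)))"
    by (subst sum.inter_restrict) simp_all
  also have "\<dots> = (\<Sum>i\<le>n. s (coeff F i) (coeff p (n - i)))"
    by (rule sum.mono_neutral_left) (auto intro!: le_degree)
  finally show ?thesis .
qed

lemma coeff_map_scale:
  assumes "module s"
  shows "coeff (map_poly (s a) p) n = s a (coeff p n)"
proof -
  interpret module s by fact
  show ?thesis by (simp add: coeff_map_poly)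
qed

lemma poly_scale_pCons_left:
  assumes "module s"
  shows "poly_scale s (pCons a F) p = map_poly (s a) p + pCons 0 (poly_scale s F p)"
proof (rule poly_eqI)
  interpret module s by fact
  show "coeff (poly_scale s (pCons a F) p) n =
      coeff (map_poly (s a) p + pCons 0 (poly_scale s F p)) n" for n
    by (cases n) (simp_all add: coeff_poly_scale[OF assms] coeff_map_scale[OF assms]
        sum.atMost_Suc_shift del: sum.atMost_Suc)
qed

lemma poly_scale_zero_left: "module s \<Longrightarrow> poly_scale s 0 p = 0"
  by (rule poly_eqI) (simp add: coeff_poly_scale module.scale_zero_left)

lemma poly_scale_zero_right: "module s \<Longrightarrow> poly_scale s F 0 = 0"
  by (rule poly_eqI) (simp add: coeff_poly_scale module.scale_zero_right)

lemma poly_scale_const: "module s \<Longrightarrow> poly_scale s [:a:] p = map_poly (s a) p"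
  by (simp add: poly_scale_pCons_left poly_scale_zero_left)

lemma poly_scale_const_pCons:
  assumes "module s"
  shows "poly_scale s [:a:] (pCons x p) = pCons (s a x) (poly_scale s [:a:] p)"
  by (rule poly_eqI)
    (simp add: poly_scale_const[OF assms] coeff_map_scale[OF assms] coeff_pCons split: nat.split)

lemma module_poly_scale:
  assumes "module s"
  shows "module (poly_scale s)"
proof -
  interpret module s by fact
  note c = coeff_poly_scale[OF assms]
  note rec = poly_scale_pCons_left[OF assms] poly_scale_zero_left[OF assms]
  have add: "poly_scale s F (p + q) = poly_scale s F p + poly_scale s F q" for F p q
    by (rule poly_eqI) (simp add: c scale_right_distrib sum.distrib)
  have add_left: "poly_scale s (F + G) p = poly_scale s F p + poly_scale s G p" for F G p
    by (rule poly_eqI) (simp add: c scale_left_distrib sum.distrib)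
  have map: "poly_scale s (smult a G) p = map_poly (s a) (poly_scale s G p)" for a G p
    by (rule poly_eqI) (simp add: c coeff_map_scale[OF assms] scale_sum_right)
  have shift: "poly_scale s (pCons 0 F) p = pCons 0 (poly_scale s F p)" for F p
  proof -
    have "map_poly (s 0) p = 0" by (rule poly_eqI) (simp add: coeff_map_scale[OF assms])
    then show ?thesis by (simp add: rec)
  qed
  have mult: "poly_scale s F (poly_scale s G p) = poly_scale s (F * G) p" for F G p
  proof (induction F)
    case (pCons a F)
    have "poly_scale s (pCons a F * G) p = map_poly (s a) (poly_scale s G p) + pCons 0 (poly_scale s (F * G) p)"
      by (simp only: mult_pCons_left add_left map shift)
    then show ?case by (simp only: pCons.IH rec(1))
  qed (simp add: rec)
  have one: "poly_scale s 1 p = p" for p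
    by (rule poly_eqI) (simp add: one_pCons poly_scale_const[OF assms] coeff_map_scale[OF assms])
  show ?thesis by standard (simp_all add: add add_left mult one)
qed

lemma poly_scale_monic_linear:
  assumes "module s"
  shows "poly_scale s [:c, 1:] p = poly_scale s [:c:] p + pCons 0 p"
proof -
  interpret P: module "poly_scale s" by (rule module_poly_scale) fact
  have "poly_scale s [:1:] p = p" using P.scale_one[of p] by (simp add: one_pCons)
  then show ?thesis
    by (simp add: poly_scale_pCons_left[OF assms, of c "[:1:]"] poly_scale_const[OF assms, of c])
qed

text \<open>The leading coefficients multiply.\<close>

lemma poly_scale_torsion_free:
  assumes "module s" and tf: "\<And>a x. s a x = 0 \<Longrightarrow> a = 0 \<or> x = 0"
    and "poly_scale s F p = 0"
  shows "F = 0 \<or> p = 0"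
proof (rule ccontr)
  assume n: "\<not> (F = 0 \<or> p = 0)"
  interpret module s by fact
  let ?m = "degree F" and ?k = "degree p"
  have "(\<Sum>i\<le>?m + ?k. s (coeff F i) (coeff p (?m + ?k - i))) =
      (\<Sum>i\<in>{?m}. s (coeff F i) (coeff p (?m + ?k - i)))"
  proof (rule sum.mono_neutral_right)
    show "\<forall>i\<in>{..?m + ?k} - {?m}. s (coeff F i) (coeff p (?m + ?k - i)) = 0"
    proof
      fix i assume "i \<in> {..?m + ?k} - {?m}"
      then have "i > ?m \<or> ?m + ?k - i > ?k" by auto
      then show "s (coeff F i) (coeff p (?m + ?k - i)) = 0"
        by (auto simp: coeff_eq_0)
    qed
  qed auto
  also have "\<dots> = s (lead_coeff F) (lead_coeff p)" by simp
  finally have "s (lead_coeff F) (lead_coeff p) = 0"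
    using assms(3) by (simp add: coeff_poly_scale[OF assms(1), symmetric])
  then show False using tf n by fastforce
qed

lemma module_hom_map_poly:
  assumes "module_hom s t \<phi>"
  shows "module_hom (poly_scale s) (poly_scale t) (map_poly \<phi>)"
proof -
  interpret module_hom s t \<phi> by fact
  interpret S: module "poly_scale s" by (rule module_poly_scale) unfold_locales
  interpret T: module "poly_scale t" by (rule module_poly_scale) unfold_locales
  have "module s" "module t" by unfold_locales
  then show ?thesis
    by unfold_locales
      (auto intro!: poly_eqI simp: coeff_map_poly zero add coeff_poly_scale sum scale)
qed

lemma inj_map_poly:
  assumes "module_hom s t \<phi>" and "inj \<phi>"
  shows "inj (map_poly \<phi>)"
proof (rule injI, rule poly_eqI)
  interpret module_hom s t \<phi> by fact
  fix p q n
  assume "map_poly \<phi> p = map_poly \<phi> q"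
  then have "coeff (map_poly \<phi> p) n = coeff (map_poly \<phi> q) n" by simp
  then show "coeff p n = coeff q n"
    using \<open>inj \<phi>\<close> by (simp add: coeff_map_poly zero inj_eq)
qed

section \<open>Substitution and iterated actions\<close>

text \<open>The sums that define \<^const>\<open>subst2\<close> and \<^const>\<open>nested\<close> both obey a Horner recursion, so that
  everything about them can be proved by induction on the polynomial.\<close>

lemma horner_sum:
  assumes "module S" and "\<psi> 0 = 0"
  shows "(\<Sum>j\<le>degree (pCons a p). S (G ^ j) (\<psi> (coeff (pCons a p) j))) =
    \<psi> a + S G (\<Sum>j\<le>degree p. S (G ^ j) (\<psi> (coeff p j)))"
proof -
  interpret module S by fact
  show ?thesis
    by (cases "p = 0")
      (simp_all add: assms(2) scale_sum_right sum.atMost_Suc_shift del: sum.atMost_Suc)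
qed

lemma module_poly_scale2: "module s \<Longrightarrow> module (poly_scale (poly_scale s))"
  by (intro module_poly_scale)

lemma subst2_pCons:
  assumes "module s"
  shows "subst2 s F (pCons x p) = [:[:x:]:] + poly_scale (poly_scale s) F (subst2 s F p)"
  unfolding subst2_def
  by (rule horner_sum[OF module_poly_scale2[OF assms], where \<psi> = "\<lambda>x. [:[:x:]:]"]) simp

lemma subst2_zero: "module s \<Longrightarrow> subst2 s F 0 = 0"
  by (simp add: subst2_def module.scale_zero_right[OF module_poly_scale2])

lemma nested_pCons:
  assumes "module s" and "\<phi> 0 = 0"
  shows "nested s \<phi> F (pCons x p) G =
    subst2 s F (\<phi> x) + poly_scale (poly_scale s) G (nested s \<phi> F p G)"
  unfolding nested_def
  by (rule horner_sum[OF module_poly_scale2[OF assms(1)], where \<psi> = "\<lambda>x. subst2 s F (\<phi> x)"])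
    (simp add: assms subst2_zero)

lemma nested_zero: "module s \<Longrightarrow> \<phi> 0 = 0 \<Longrightarrow> nested s \<phi> F 0 G = 0"
  by (simp add: nested_def subst2_zero module.scale_zero_right[OF module_poly_scale2])

lemma subst2_add:
  assumes "module s"
  shows "subst2 s F (p + q) = subst2 s F p + subst2 s F q"
proof -
  interpret S: module "poly_scale (poly_scale s)" by (rule module_poly_scale2) fact
  show ?thesis
    by (induction p q rule: poly_induct2)
      (simp_all add: subst2_zero[OF assms] subst2_pCons[OF assms] S.scale_right_distrib)
qed

lemma nested_add:
  assumes "module s" and zero: "\<phi> 0 = 0" and add: "\<And>x y. \<phi> (x + y) = \<phi> x + \<phi> y"
  shows "nested s \<phi> F (p + q) G = nested s \<phi> F p G + nested s \<phi> F q G"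
proof -
  interpret S: module "poly_scale (poly_scale s)" by (rule module_poly_scale2) fact
  show ?thesis
    by (induction p q rule: poly_induct2)
      (simp_all add: nested_zero[of s \<phi>, OF assms(1,2)] nested_pCons[of s \<phi>, OF assms(1,2)]
        add subst2_add[OF assms(1)] S.scale_right_distrib)
qed

lemma poly_scale2_const:
  assumes "module s"
  shows "poly_scale (poly_scale s) [:[:c:]:] [:[:x:]:] = [:[:s c x:]:]"
  by (simp add: poly_scale_const_pCons[OF module_poly_scale[OF assms]]
      poly_scale_const_pCons[OF assms] poly_scale_zero_right[OF assms]
      poly_scale_zero_right[OF module_poly_scale[OF assms]])

lemma subst2_scale_const:
  assumes "module s"
  shows "subst2 s F (poly_scale s [:c:] p) = poly_scale (poly_scale s) [:[:c:]:] (subst2 s F p)"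
proof -
  interpret S: module "poly_scale (poly_scale s)" by (rule module_poly_scale2) fact
  show ?thesis
    by (induction p)
      (simp_all add: poly_scale_zero_right[OF assms] subst2_zero[OF assms]
        poly_scale_const_pCons[OF assms] subst2_pCons[OF assms] S.scale_right_distrib
        poly_scale2_const[OF assms] S.scale_left_commute del: S.scale_scale)
qed

text \<open>Evaluation at \<open>F\<close> turns the scalar \<open>c + x\<close> into \<open>c + F\<close>.\<close>

lemma subst2_scale_linear:
  assumes "module s"
  shows "subst2 s F (poly_scale s [:c, 1:] p) =
    poly_scale (poly_scale s) ([:[:c:]:] + F) (subst2 s F p)"
proof -
  interpret S: module "poly_scale (poly_scale s)" by (rule module_poly_scale2) fact
  show ?thesis
    by (simp add: poly_scale_monic_linear[OF assms] subst2_add[OF assms]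
        subst2_scale_const[OF assms] subst2_pCons[OF assms] S.scale_left_distrib)
qed

text \<open>Together with \<open>nested_scale_arg\<close> this moves a linear factor out of each of the three terms of the
  Jacobi identity: here out of \<open>[a\<^sub>\<lambda>b]\<^sub>F v\<close>, where it turns into \<open>c + F\<close> with \<open>F = \<lambda> + \<mu>\<close>.\<close>

lemma nested_scale_fun:
  assumes "module s"
  shows "nested s (\<lambda>x. poly_scale s [:c, 1:] (\<phi> x)) F p G =
    poly_scale (poly_scale s) ([:[:c:]:] + F) (nested s \<phi> F p G)"
proof -
  interpret S: module "poly_scale (poly_scale s)" by (rule module_poly_scale2) fact
  show ?thesis
    unfolding nested_def
    by (simp add: subst2_scale_linear[OF assms] S.scale_sum_right mult.commute)
qed

text \<open>In \<open>a\<^sub>F(b\<^sub>G v)\<close> the factor \<open>c + x\<close> of \<open>b\<^sub>x v\<close> becomes \<open>c + G\<close> at \<open>x = G\<close>, and sesquilinearity of the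
  outer action turns its constant term \<open>c\<close>, a polynomial in \<open>\<partial>\<close>, into \<open>c + F\<close>.\<close>

lemma nested_scale_arg:
  assumes "module s" and zero: "\<phi> 0 = 0" and add: "\<And>x y. \<phi> (x + y) = \<phi> x + \<phi> y"
    and sesq: "\<And>x. \<phi> (s c x) = poly_scale s [:c, 1:] (\<phi> x)"
  shows "nested s \<phi> F (poly_scale s [:c, 1:] p) G =
    poly_scale (poly_scale s) ([:[:c:]:] + F + G) (nested s \<phi> F p G)"
proof -
  interpret S: module "poly_scale (poly_scale s)" by (rule module_poly_scale2) fact
  note rec = nested_zero[of s \<phi>, OF assms(1,2)] nested_pCons[of s \<phi>, OF assms(1,2)]
  have const: "nested s \<phi> F (poly_scale s [:c:] p) G =
      poly_scale (poly_scale s) ([:[:c:]:] + F) (nested s \<phi> F p G)"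
    by (induction p)
      (simp_all add: rec poly_scale_zero_right[OF assms(1)] poly_scale_const_pCons[OF assms(1)]
        sesq subst2_scale_linear[OF assms(1)] S.scale_right_distrib mult.commute)
  show ?thesis
    by (simp add: poly_scale_monic_linear[OF assms(1)] nested_add[OF assms(1) zero add] const rec
        zero subst2_zero[OF assms(1)] S.scale_left_distrib)
qed

text \<open>With \<open>nested_map_arg\<close>, transports the Jacobi identity along an inclusion of modules.\<close>

lemma nested_hom:
  assumes hom: "module_hom s t \<iota>" and zero: "\<phi> 0 = 0"
  shows "nested t (\<lambda>x. map_poly \<iota> (\<phi> x)) F p G = map_poly (map_poly \<iota>) (nested s \<phi> F p G)"
proof -
  interpret H: module_hom s t \<iota> by fact
  have s: "module s" and t: "module t" by unfold_locales
  interpret H2: module_hom "poly_scale (poly_scale s)" "poly_scale (poly_scale t)" "map_poly (map_poly \<iota>)"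
    by (intro module_hom_map_poly hom)
  have sub: "subst2 t F (map_poly \<iota> q) = map_poly (map_poly \<iota>) (subst2 s F q)" for q
    by (induction q) (simp_all add: subst2_zero s t subst2_pCons map_poly_pCons H.zero H2.add H2.scale)
  have z: "map_poly \<iota> (\<phi> 0) = 0" by (simp add: zero)
  show ?thesis
    by (induction p) (simp_all add: nested_zero[of t "\<lambda>x. map_poly \<iota> (\<phi> x)", OF t z] nested_zero[of s \<phi>, OF s zero]
      nested_pCons[of t "\<lambda>x. map_poly \<iota> (\<phi> x)", OF t z] nested_pCons[of s \<phi>, OF s zero] sub H2.add H2.scale)
qed

lemma nested_map_arg:
  assumes "module t" and "\<iota> 0 = 0" and "\<phi> 0 = 0"
  shows "nested t \<phi> F (map_poly \<iota> p) G = nested t (\<lambda>x. \<phi> (\<iota> x)) F p G"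
proof -
  have z: "\<phi> (\<iota> 0) = 0" by (simp add: assms)
  show ?thesis
    by (induction p) (simp_all add: nested_zero[of t \<phi>, OF assms(1,3)]
      nested_zero[of t "\<lambda>x. \<phi> (\<iota> x)", OF assms(1) z] nested_pCons[of t \<phi>, OF assms(1,3)]
      nested_pCons[of t "\<lambda>x. \<phi> (\<iota> x)", OF assms(1) z] map_poly_pCons assms(2))
qed

section \<open>Modules over \<open>\<complex>[\<partial>]\<close> from a single operator\<close>

lemma scale_pCons:
  assumes "module s"
  shows "s (pCons a q) x = s [:a:] x + s del (s q x)"
proof -
  interpret module s by fact
  have "s ([:a:] + del * q) x = s [:a:] x + s del (s q x)"
    by (simp only: scale_left_distrib scale_scale)
  then show ?thesis by simp
qed

text \<open>\<open>\<complex>[\<partial>]\<close> is generated by the constants and \<open>\<partial>\<close>.\<close>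

lemma scale_mem:
  assumes "module s" and "x \<in> S"
    and "\<And>x y. x \<in> S \<Longrightarrow> y \<in> S \<Longrightarrow> x + y \<in> S"
    and const: "\<And>z x. x \<in> S \<Longrightarrow> s [:z:] x \<in> S" and "\<And>x. x \<in> S \<Longrightarrow> s del x \<in> S"
  shows "s q x \<in> S"
proof (induction q)
  case 0
  show ?case using const[of x 0] assms(2) by simp
next
  case (pCons a q)
  then show ?case
    using assms(2-) scale_pCons[OF assms(1), of a q x] by simp
qed

lemma module_homI:
  fixes s :: "complex poly \<Rightarrow> 'a::ab_group_add \<Rightarrow> 'a" and t :: "complex poly \<Rightarrow> 'b::ab_group_add \<Rightarrow> 'b"
  assumes "module s" and "module t" and add: "\<And>x y. \<phi> (x + y) = \<phi> x + \<phi> y"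
    and const: "\<And>z x. \<phi> (s [:z:] x) = t [:z:] (\<phi> x)" and del: "\<And>x. \<phi> (s del x) = t del (\<phi> x)"
  shows "module_hom s t \<phi>"
proof -
  interpret S: module s by fact
  interpret T: module t by fact
  have zero: "\<phi> 0 = 0" using add[of 0 0] by simp
  have "\<phi> (s q x) = t q (\<phi> x)" for q x
  proof (induction q)
    case (pCons a q)
    then show ?case
      by (simp only: scale_pCons[OF assms(1), of a q x] scale_pCons[OF assms(2), of a q "\<phi> x"]
          add const del)
  qed (simp add: zero)
  then show ?thesis by unfold_locales (simp_all add: add)
qed

text \<open>The module structure of \<^const>\<open>twisted_sum\<close>: polynomials act through the operator \<open>T\<close>, and
  only the constants of the given structure \<open>D\<close> are used.\<close>

definition operator_scale ::
    "(complex poly \<Rightarrow> 'e::ab_group_add \<Rightarrow> 'e) \<Rightarrow> ('e \<Rightarrow> 'e) \<Rightarrow> complex poly \<Rightarrow> 'e \<Rightarrow> 'e" where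
  "operator_scale D T q x = (\<Sum>j\<le>degree q. D [:coeff q j:] ((T ^^ j) x))"

context
  fixes D :: "complex poly \<Rightarrow> 'e::ab_group_add \<Rightarrow> 'e" and T :: "'e \<Rightarrow> 'e"
  assumes D: "module D" and add: "\<And>x y. T (x + y) = T x + T y"
    and const: "\<And>z x. T (D [:z:] x) = D [:z:] (T x)"
begin

interpretation module D by (rule D)

lemma operator_zero: "T 0 = 0"
  using add[of 0 0] by simp

lemma operator_scale_0: "operator_scale D T 0 x = 0"
  by (simp add: operator_scale_def)

lemma operator_scale_pCons:
  "operator_scale D T (pCons a q) x = D [:a:] x + T (operator_scale D T q x)"
proof (cases "q = 0")
  case False
  have "T (operator_scale D T q x) = (\<Sum>j\<le>degree q. T (D [:coeff q j:] ((T ^^ j) x)))"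
    unfolding operator_scale_def
    using sum_comp_morphism[of T "\<lambda>j. D [:coeff q j:] ((T ^^ j) x)" "{..degree q}"]
    by (simp add: operator_zero add o_def)
  then show ?thesis using False
    by (simp add: operator_scale_def const sum.atMost_Suc_shift del: sum.atMost_Suc)
qed (simp add: operator_scale_def operator_zero)

lemma module_operator_scale: "module (operator_scale D T)"
proof -
  note rec = operator_scale_0 operator_scale_pCons
  have const_add: "D [:a + b:] x = D [:a:] x + D [:b:] x" for a b x
    using scale_left_distrib[of "[:a:]" "[:b:]" x] by simp
  have const_mult: "D [:a * b:] x = D [:a:] (D [:b:] x)" for a b x
    using scale_scale[of "[:a:]" "[:b:]" x] by (simp add: mult.commute)
  have one: "operator_scale D T 1 x = x" for x
    using scale_one[of x] by (simp add: one_pCons rec operator_zero)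
  have right: "operator_scale D T q (x + y) = operator_scale D T q x + operator_scale D T q y" for q x y
    by (induction q) (simp_all add: rec add scale_right_distrib)
  have left: "operator_scale D T (p + q) x = operator_scale D T p x + operator_scale D T q x" for p q x
    by (induction p q rule: poly_induct2) (simp_all add: rec add const_add)
  have smult: "operator_scale D T (smult a q) x = D [:a:] (operator_scale D T q x)" for a q x
    by (induction q) (simp_all add: rec add const scale_right_distrib const_mult del: scale_scale)
  have mult: "operator_scale D T p (operator_scale D T q x) = operator_scale D T (p * q) x" for p q x
  proof (induction p)
    case (pCons a p)
    have "operator_scale D T (pCons a p * q) x =
        D [:a:] (operator_scale D T q x) + T (operator_scale D T (p * q) x)"
      by (simp only: mult_pCons_left left smult rec) simp
    then show ?case by (simp only: pCons.IH rec)
  qed (simp add: rec)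
  show ?thesis by unfold_locales (simp_all add: right left mult one)
qed

lemma operator_scale_const: "operator_scale D T [:z:] x = D [:z:] x"
  by (simp add: operator_scale_pCons operator_scale_0 operator_zero)

lemma operator_scale_del: "operator_scale D T del x = T x"
  using scale_one[of x] by (simp add: operator_scale_pCons operator_scale_0 operator_zero one_pCons)

end

section \<open>Conformal actions and division by a linear factor\<close>

lemma lambda_actionD:
  assumes "lambda_action sR br s action"
  shows "action (a + b) v = action a v + action b v"
    and "action a (v + w) = action a v + action a w"
    and "action (sR [:z:] a) v = poly_scale s [:[:z:]:] (action a v)"
    and "action a (s [:z:] v) = poly_scale s [:[:z:]:] (action a v)"
    and "action (sR del a) v = poly_scale s (- lam1) (action a v)"
    and "action a (s del v) = poly_scale s (del1 + lam1) (action a v)"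
    and "nested s (action a) lam2 (action b v) mu2 =
      nested s (\<lambda>r. action r v) (lam2 + mu2) (br a b) lam2 + nested s (action b) mu2 (action a v) lam2"
  using assms unfolding lambda_action_def by blast+

lemma lambda_action_zero:
  assumes "lambda_action sR br s action"
  shows "action 0 v = 0" and "action a 0 = 0"
  using lambda_actionD(1)[OF assms, of 0 0 v] lambda_actionD(2)[OF assms, of a 0 0] by simp_all

text \<open>Applied to \<open>\<partial> - \<eta>\<close>, this is the identity \<open>a\<^sub>\<lambda>((\<partial> - \<eta>)v) = (\<partial> + \<lambda> - \<eta>)a\<^sub>\<lambda>v\<close>.\<close>

lemma lambda_action_linear:
  assumes "lambda_action sR br s action" and "module s"
  shows "action a (s [:c, 1:] v) = poly_scale s [:[:c, 1:], 1:] (action a v)"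
proof -
  interpret module s by fact
  interpret P: module "poly_scale s" by (rule module_poly_scale) fact
  have "action a (s ([:c:] + del) v) = poly_scale s ([:[:c:]:] + (del1 + lam1)) (action a v)"
    by (simp only: scale_left_distrib[of "[:c:]" del] P.scale_left_distrib[of "[:[:c:]:]"]
        lambda_actionD(2,4,6)[OF assms(1)])
  then show ?thesis by simp
qed

lemma poly_scale_cancel:
  assumes "module s" and tf: "\<And>a x. s a x = 0 \<Longrightarrow> a = 0 \<or> x = 0" and "F \<noteq> 0"
    and "poly_scale s F p = poly_scale s F q"
  shows "p = q"
proof -
  interpret P: module "poly_scale s" by (rule module_poly_scale) fact
  have "poly_scale s F (p - q) = 0" by (simp add: P.scale_right_diff_distrib assms(4))
  then show ?thesis using poly_scale_torsion_free[OF assms(1) tf] assms(3) by fastforce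
qed

text \<open>Let \<open>\<iota>: V \<rightarrow> E\<close> and \<open>\<theta>: E \<rightarrow> V\<close> be \<open>\<complex>[\<partial>]\<close>-linear with \<open>\<theta>\<iota> = \<partial> + c\<close>.  If every
  \<open>a\<^sub>\<lambda>\<theta>(e)\<close> is divisible by \<open>\<partial> + \<lambda> + c\<close>, with quotient \<open>K a e\<close>, then \<open>\<iota>(K a e)\<close> is an action on \<open>E\<close>
  that extends the action on \<open>V\<close>.  Each axiom holds after multiplication by a linear factor,
  where it is the axiom of \<open>V\<close> at \<open>\<theta>(e)\<close>, and the factor cancels because \<open>V[\<lambda>]\<close> and \<open>V[\<lambda>,\<mu>]\<close> have no torsion.\<close>

lemma lambda_action_pullback:
  assumes la: "lambda_action sR br s action" and s: "module s"
    and tf: "\<And>a x. s a x = 0 \<Longrightarrow> a = 0 \<or> x = 0"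
    and \<iota>: "module_hom s t \<iota>" and \<theta>: "module_hom t s \<theta>" and \<theta>\<iota>: "\<And>y. \<theta> (\<iota> y) = s [:c, 1:] y"
    and K: "\<And>a x. poly_scale s [:[:c, 1:], 1:] (K a x) = action a (\<theta> x)"
  shows "lambda_action sR br t (\<lambda>a x. map_poly \<iota> (K a x))"
proof -
  let ?H = "[:[:c, 1:], 1:] :: complex poly poly"
  let ?H2 = "[:[:[:c, 1:]:]:] + lam2 + mu2 :: complex poly poly poly"
  note D = lambda_actionD[OF la]
  interpret P: module "poly_scale s" by (rule module_poly_scale) fact
  interpret S2: module "poly_scale (poly_scale s)" by (rule module_poly_scale2) fact
  interpret \<iota>: module_hom s t \<iota> by fact
  interpret \<theta>: module_hom t s \<theta> by fact
  interpret I: module_hom "poly_scale s" "poly_scale t" "map_poly \<iota>"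
    by (rule module_hom_map_poly) fact
  interpret I2: module_hom "poly_scale (poly_scale s)" "poly_scale (poly_scale t)" "map_poly (map_poly \<iota>)"
    by (intro module_hom_map_poly \<iota>)
  have t: "module t" by unfold_locales
  have cancel: "p = q" if "poly_scale s ?H p = poly_scale s ?H q" for p q
    using poly_scale_cancel[OF s tf _ that] by simp
  have cancel2: "p = q" if "poly_scale (poly_scale s) ?H2 p = poly_scale (poly_scale s) ?H2 q" for p q
    using poly_scale_cancel[OF module_poly_scale[OF s] poly_scale_torsion_free[OF s tf] _ that] by simp
  \<comment> \<open>So \<open>\<iota>\<close> intertwines the two actions, which reduces nested actions on \<open>E\<close> to nested actions on \<open>V\<close>.\<close>
  have K_\<iota>: "K a (\<iota> y) = action a y" for a y
    by (rule cancel) (simp only: K \<theta>\<iota> lambda_action_linear[OF la s])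
  have add_left: "K (a + b) x = K a x + K b x" for a b x
    by (rule cancel) (simp only: K D P.scale_right_distrib)
  have add_right: "K a (x + y) = K a x + K a y" for a x y
    by (rule cancel) (simp only: K \<theta>.add D P.scale_right_distrib)
  have const_left: "K (sR [:z:] a) x = poly_scale s [:[:z:]:] (K a x)" for z a x
    by (rule cancel) (simp only: K D P.scale_left_commute[of ?H])
  have const_right: "K a (t [:z:] x) = poly_scale s [:[:z:]:] (K a x)" for z a x
    by (rule cancel) (simp only: K D \<theta>.scale P.scale_left_commute[of ?H])
  have del_left: "K (sR del a) x = poly_scale s (- lam1) (K a x)" for a x
    by (rule cancel) (simp only: K D P.scale_left_commute[of ?H])
  have del_right: "K a (t del x) = poly_scale s (del1 + lam1) (K a x)" for a x
    by (rule cancel) (simp only: K D \<theta>.scale P.scale_left_commute[of ?H])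
  have zero: "action a 0 = 0" "K 0 x = 0" "K a 0 = 0" for a x
    using lambda_action_zero[OF la] add_left[of 0 0 x] add_right[of a 0 0] by simp_all
  have outer: "poly_scale (poly_scale s) ([:[:[:c, 1:]:]:] + F + G) (nested s (action a) F (K b x) G) =
      nested s (action a) F (action b (\<theta> x)) G" for a b x F G
    by (subst nested_scale_arg[symmetric])
      (simp_all only: s zero D lambda_action_linear[OF la s] K)
  have inner: "poly_scale (poly_scale s) ([:[:[:c, 1:]:]:] + F) (nested s (\<lambda>r. K r x) F p G) =
      nested s (\<lambda>r. action r (\<theta> x)) F p G" for x F p G
    by (subst nested_scale_fun[symmetric]) (simp_all only: s K)
  \<comment> \<open>The factor \<open>\<partial> + \<lambda> + \<mu> + c\<close> comes out of all three terms and leaves the Jacobi identity at \<open>\<theta>(x)\<close>.\<close>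
  have jacobi: "nested s (action a) lam2 (K b x) mu2 =
      nested s (\<lambda>r. K r x) (lam2 + mu2) (br a b) lam2 + nested s (action b) mu2 (K a x) lam2" for a b x
  proof (rule cancel2)
    have F: "[:[:[:c, 1:]:]:] + mu2 + lam2 = ?H2" "[:[:[:c, 1:]:]:] + (lam2 + mu2) = ?H2"
      by (simp_all only: add_ac)
    have "poly_scale (poly_scale s) ?H2 (nested s (action b) mu2 (K a x) lam2) =
        nested s (action b) mu2 (action a (\<theta> x)) lam2"
      using outer[of mu2 lam2 b a x] by (simp only: F)
    moreover have "poly_scale (poly_scale s) ?H2 (nested s (\<lambda>r. K r x) (lam2 + mu2) (br a b) lam2) =
        nested s (\<lambda>r. action r (\<theta> x)) (lam2 + mu2) (br a b) lam2"
      using inner[of "lam2 + mu2" x "br a b" lam2] by (simp only: F)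
    ultimately show "poly_scale (poly_scale s) ?H2 (nested s (action a) lam2 (K b x) mu2) =
        poly_scale (poly_scale s) ?H2
         (nested s (\<lambda>r. K r x) (lam2 + mu2) (br a b) lam2 + nested s (action b) mu2 (K a x) lam2)"
      by (simp only: S2.scale_right_distrib outer D(7)[of a b "\<theta> x"])
  qed
  have "nested t (\<lambda>x. map_poly \<iota> (K a x)) F (map_poly \<iota> p) G =
      map_poly (map_poly \<iota>) (nested s (action a) F p G)" for a F p G
    by (subst nested_map_arg) (simp_all add: t zero K_\<iota> nested_hom[OF \<iota>])
  moreover have "nested t (\<lambda>r. map_poly \<iota> (K r x)) F p G =
      map_poly (map_poly \<iota>) (nested s (\<lambda>r. K r x) F p G)" for x F p G
    by (rule nested_hom[OF \<iota>]) (rule zero)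
  ultimately show ?thesis
    unfolding lambda_action_def
    by (simp only: add_left add_right const_left const_right del_left del_right
        I.add I.scale I2.add jacobi simp_thms)
qed

section \<open>Extensions of a one-dimensional module\<close>

lemma extensionD:
  assumes "extension R V W E i p"
  shows "module (mscale V)" "module (mscale W)" "module (mscale E)"
    and "lambda_action (lscale R) (bracket R) (mscale V) (act V)"
    and "lambda_action (lscale R) (bracket R) (mscale E) (act E)"
    and "module_hom (mscale V) (mscale E) i" "module_hom (mscale E) (mscale W) p"
    and "act E a (i v) = map_poly i (act V a v)"
    and "act W a (p e) = map_poly p (act E a e)"
    and "inj i" "surj p" "p (i v) = 0" "p e = 0 \<Longrightarrow> \<exists>v. e = i v"
  using assms unfolding extension_def conformal_module_def cmod_hom_def by blast+

lemma one_dim_simps [simp]: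
  "mscale (one_dim \<eta>) q z = poly q \<eta> * z" "act (one_dim \<eta>) a z = 0"
  by (simp_all add: one_dim_def)

lemma nested_zero_fun: "module s \<Longrightarrow> nested s (\<lambda>_. 0) F p G = 0"
  by (simp add: nested_def subst2_zero module.scale_zero_right[OF module_poly_scale2])

lemma conformal_module_one_dim:
  assumes "lie_conformal_algebra R"
  shows "conformal_module R (one_dim \<eta>)"
proof -
  have m: "module (mscale (one_dim \<eta> :: ('a, complex) cmod))"
    by unfold_locales (simp_all add: algebra_simps)
  have "act (one_dim \<eta>) = (\<lambda>(a :: 'a) z. 0)" by (intro ext) simp
  then show ?thesis
    by (simp add: conformal_module_def assms m lambda_action_def poly_scale_zero_right[OF m]
        nested_zero_fun[OF m])
qed

lemma direct_sum_simps:
  "mscale (direct_sum V W) q x = (mscale V q (fst x), mscale W q (snd x))"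
  "act (direct_sum V W) a x =
    map_poly (\<lambda>v. (v, 0)) (act V a (fst x)) + map_poly (\<lambda>w. (0, w)) (act W a (snd x))"
  by (simp_all add: direct_sum_def)

lemma module_direct_sum:
  assumes "module (mscale V)" "module (mscale W)"
  shows "module (mscale (direct_sum V W))"
proof -
  interpret V: module "mscale V" by fact
  interpret W: module "mscale W" by fact
  show ?thesis
    by unfold_locales (simp_all add: direct_sum_simps V.scale_right_distrib W.scale_right_distrib
        V.scale_left_distrib W.scale_left_distrib)
qed

text \<open>Freeness of \<open>V\<close> enters the description of extensions and cocycles only through the absence of
  torsion.\<close>

locale torsion_free_cmod =
  fixes R :: "'r::ab_group_add lca" and V :: "('r, 'v::ab_group_add) cmod" and \<eta> :: complex
  assumes conformal: "conformal_module R V"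
    and torsion_free: "\<And>q x. mscale V q x = 0 \<Longrightarrow> q = 0 \<or> x = 0"
begin

abbreviation s where "s \<equiv> mscale V"
text \<open>The polynomial \<open>\<partial> - \<eta>\<close>, which annihilates \<open>c\<^sub>\<eta>\<close>.\<close>

abbreviation root :: "complex poly" where "root \<equiv> [:- \<eta>, 1:]"
text \<open>The polynomial \<open>\<partial> + \<lambda> - \<eta>\<close>.\<close>

abbreviation shift :: "complex poly poly" where "shift \<equiv> [:root, 1:]"

lemma s: "module s" and act_V: "lambda_action (lscale R) (bracket R) s (act V)"
  and lie: "lie_conformal_algebra R"
  using conformal by (simp_all add: conformal_module_def)

sublocale V: module s by (rule s)
sublocale P: module "poly_scale s" by (rule module_poly_scale[OF s])

lemma shift_cancel: "poly_scale s shift p = poly_scale s shift q \<Longrightarrow> p = q"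
  by (rule poly_scale_cancel[OF s torsion_free, of shift]) simp_all

text \<open>The condition on \<open>x\<close> for the existence of an extension with a preimage \<open>c\<close> of \<open>c\<^sub>\<eta>\<close> such that
  \<open>(\<partial> - \<eta>)c = x\<close>; the quotient of \<open>a\<^sub>\<lambda>x\<close> by \<open>\<partial> + \<lambda> - \<eta>\<close> is then \<open>a\<^sub>\<lambda>c\<close>.\<close>

definition shift_divides :: "'v \<Rightarrow> bool" where
  "shift_divides x \<longleftrightarrow> (\<forall>a. \<exists>f. poly_scale s shift f = act V a x)"

definition shift_quot :: "'v \<Rightarrow> 'r \<Rightarrow> 'v poly" where
  "shift_quot x a = (THE f. poly_scale s shift f = act V a x)"

lemma shift_quot_eq: "poly_scale s shift f = act V a x \<Longrightarrow> shift_quot x a = f"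
  unfolding shift_quot_def by (rule the_equality) (auto intro: shift_cancel)

lemma shift_quot_spec: "shift_divides x \<Longrightarrow> poly_scale s shift (shift_quot x a) = act V a x"
  unfolding shift_divides_def using shift_quot_eq by metis

lemma shift_quot_zero: "shift_quot 0 a = 0"
  by (rule shift_quot_eq) (simp add: lambda_action_zero[OF act_V])

lemma shift_divides_zero: "shift_divides 0"
  unfolding shift_divides_def by (intro allI exI[of _ 0]) (simp add: lambda_action_zero[OF act_V])

lemma root_generator:
  assumes "extension R V (one_dim \<eta>) E i p"
  obtains x where "mscale E root c = i x"
proof -
  interpret p: module_hom "mscale E" "mscale (one_dim \<eta> :: ('r, complex) cmod)" p
    by (rule extensionD(7)) fact
  have "p (mscale E root c) = 0" by (simp add: p.scale)
  then show thesis using extensionD(13)[OF assms] that by blast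
qed

text \<open>The values of \<open>a\<^sub>\<lambda>c\<close> vanish in \<open>\<complex>c\<^sub>\<eta>\<close>, so they come from \<open>V\<close>; sesquilinearity identifies them as
  the quotient.\<close>

lemma generator_action:
  assumes "extension R V (one_dim \<eta>) E i p" and c: "mscale E root c = i x"
  shows "shift_divides x" and "act E a c = map_poly i (shift_quot x a)"
proof -
  note D = extensionD[OF assms(1)]
  interpret i: module_hom s "mscale E" i by (rule D(6))
  interpret I: module_hom "poly_scale s" "poly_scale (mscale E)" "map_poly i"
    by (rule module_hom_map_poly) (rule D(6))
  have *: "\<exists>f. act E a c = map_poly i f \<and> poly_scale s shift f = act V a x" for a
  proof -
    have "map_poly p (act E a c) = 0" using D(9)[of a c] by simp
    then have "coeff (map_poly p (act E a c)) n = 0" for n by simp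
    then have "p (coeff (act E a c) n) = 0" for n
      by (simp add: coeff_map_poly module_hom.zero[OF D(7)])
    then have "i (inv i (coeff (act E a c) n)) = coeff (act E a c) n" for n
      using D(13) by (metis f_inv_into_f rangeI)
    moreover have "inv i 0 = 0" by (metis D(10) i.zero inv_f_f)
    \<comment> \<open>Coefficients beyond the degree are zero, so the pointwise preimage is a polynomial.\<close>
    ultimately have f: "act E a c = map_poly i (map_poly (inv i) (act E a c))"
      by (intro poly_eqI) (simp add: coeff_map_poly i.zero)
    have "map_poly i (poly_scale s shift (map_poly (inv i) (act E a c))) = map_poly i (act V a x)"
      using lambda_action_linear[OF D(5,3), of a "- \<eta>" c] f
      by (simp add: I.scale c D(8))
    then show ?thesis
      using f inj_map_poly[OF D(6,10)] by (auto dest: injD)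
  qed
  then show "shift_divides x" unfolding shift_divides_def by blast
  then show "act E a c = map_poly i (shift_quot x a)"
    using *[of a] shift_quot_eq by blast
qed

lemma extension_decomposition:
  assumes "extension R V (one_dim \<eta>) E i p" and "p c = 1"
  obtains y where "e = i y + mscale E [:p e:] c"
proof -
  note D = extensionD[OF assms(1)]
  interpret p: module_hom "mscale E" "mscale (one_dim \<eta> :: ('r, complex) cmod)" p
    by (rule D(7))
  have "p (e - mscale E [:p e:] c) = 0" by (simp add: p.diff p.scale assms(2))
  then obtain y where "e - mscale E [:p e:] c = i y" using D(13) by blast
  then have "e = i y + mscale E [:p e:] c" by (simp add: algebra_simps)
  then show thesis using that by blast
qed

lemma scale_generator:
  assumes "extension R V (one_dim \<eta>) E i p" and "mscale E root c = i x"
  shows "mscale E del c = mscale E [:\<eta>:] c + i x"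
proof -
  interpret E: module "mscale E" by (rule extensionD(3)) fact
  have "mscale E ([:\<eta>:] + root) c = mscale E [:\<eta>:] c + i x"
    by (simp only: E.scale_left_distrib assms(2))
  then show ?thesis by simp
qed

text \<open>The element \<open>x = (\<partial> - \<eta>)c\<close> is a complete invariant of an extension with a chosen preimage \<open>c\<close>:
  the isomorphism is the identity on \<open>V\<close> and sends \<open>c\<close> to \<open>c'\<close>.\<close>

lemma equiv_ext_of_generators:
  assumes E: "extension R V (one_dim \<eta>) E i p" and E': "extension R V (one_dim \<eta>) E' i' p'"
    and c: "p c = 1" "mscale E root c = i x" and c': "p' c' = 1" "mscale E' root c' = i' x"
  shows "equiv_ext E i p E' i' p'"
proof -
  note D = extensionD[OF E] and D' = extensionD[OF E']
  interpret i: module_hom s "mscale E" i by (rule D(6))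
  interpret i': module_hom s "mscale E'" i' by (rule D'(6))
  interpret p: module_hom "mscale E" "mscale (one_dim \<eta> :: ('r, complex) cmod)" p by (rule D(7))
  interpret p': module_hom "mscale E'" "mscale (one_dim \<eta> :: ('r, complex) cmod)" p' by (rule D'(7))
  interpret I: module_hom "poly_scale s" "poly_scale (mscale E)" "map_poly i"
    by (rule module_hom_map_poly) (rule D(6))
  interpret I': module_hom "poly_scale s" "poly_scale (mscale E')" "map_poly i'"
    by (rule module_hom_map_poly) (rule D'(6))
  \<comment> \<open>The component of \<open>e\<close> in \<open>V\<close> with respect to the decomposition \<open>E = V \<oplus> \<complex>c\<close>.\<close>
  define y where "y = (\<lambda>e. SOME y. e = i y + mscale E [:p e:] c)"
  have y: "e = i (y e) + mscale E [:p e:] c" for e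
    unfolding y_def by (rule someI_ex) (metis extension_decomposition[OF E c(1)])
  have y_eq: "y e = z" if "e = i z + mscale E [:p e:] c" for e z
    using y[of e] that D(10) by (metis add_right_cancel injD)
  define \<phi> where "\<phi> = (\<lambda>e. i' (y e) + mscale E' [:p e:] c')"
  have p_const: "mscale E [:a + b:] e = mscale E [:a:] e + mscale E [:b:] e"
    "mscale E' [:a + b:] e' = mscale E' [:a:] e' + mscale E' [:b:] e'" for a b e e'
    using i.m2.scale_left_distrib[of "[:a:]" "[:b:]"] i'.m2.scale_left_distrib[of "[:a:]" "[:b:]"]
    by simp_all
  have y_add: "y (e + e') = y e + y e'" for e e'
    by (rule y_eq, subst (1) y[of e], subst (1) y[of e'])
      (simp add: i.add p.add p_const algebra_simps)
  have y_const: "y (mscale E [:z:] e) = s [:z:] (y e)" for z e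
    by (rule y_eq, subst (1) y[of e])
      (simp add: i.scale p.scale i.m2.scale_right_distrib algebra_simps)
  have y_del: "y (mscale E del e) = s del (y e) + s [:p e:] x" for e
  proof (rule y_eq)
    have "mscale E del e = mscale E del (i (y e)) + mscale E [:p e:] (mscale E del c)"
      by (subst (1) y[of e]) (simp add: i.m2.scale_right_distrib)
    also have "\<dots> = i (s del (y e) + s [:p e:] x) + mscale E [:\<eta> * p e:] c"
      by (simp add: scale_generator[OF E c(2)] i.m2.scale_right_distrib i.add i.scale algebra_simps)
    moreover have "p (mscale E del e) = \<eta> * p e" by (simp add: p.scale)
    ultimately show "mscale E del e = i (s del (y e) + s [:p e:] x) + mscale E [:p (mscale E del e):] c"
      by (simp only:)
  qed
  have y_i: "y (i v) = v" for v by (rule y_eq) (simp add: D(12))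
  have y_zero: "y 0 = 0" using y_i[of 0] by simp
  have hom: "module_hom (mscale E) (mscale E') \<phi>"
  proof (rule module_homI[OF D(3) D'(3)])
    show "\<phi> (e + e') = \<phi> e + \<phi> e'" for e e'
      by (simp add: \<phi>_def y_add i'.add p.add p_const)
    show "\<phi> (mscale E [:z:] e) = mscale E' [:z:] (\<phi> e)" for z e
      by (simp add: \<phi>_def y_const i'.scale p.scale i'.m2.scale_right_distrib algebra_simps)
    show "\<phi> (mscale E del e) = mscale E' del (\<phi> e)" for e
    proof -
      have "mscale E' del (\<phi> e) = mscale E' del (i' (y e)) + mscale E' [:p e:] (mscale E' del c')"
        by (simp add: \<phi>_def i'.m2.scale_right_distrib)
      also have "\<dots> = i' (s del (y e) + s [:p e:] x) + mscale E' [:\<eta> * p e:] c'"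
        by (simp add: scale_generator[OF E' c'(2)] i'.m2.scale_right_distrib i'.add i'.scale algebra_simps)
      finally show ?thesis by (simp add: \<phi>_def y_del p.scale)
    qed
  qed
  have \<phi>_i: "\<phi> (i v) = i' v" for v by (simp add: \<phi>_def y_i D(12))
  have "act E' a (\<phi> e) = map_poly \<phi> (act E a e)" for a e
  proof -
    let ?f = "act V a (y e) + poly_scale s [:[:p e:]:] (shift_quot x a)"
    have "act E' a (\<phi> e) = map_poly i' ?f"
      by (simp add: \<phi>_def lambda_actionD(2,4)[OF D'(5)] D'(8) generator_action(2)[OF E' c'(2)]
          I'.add I'.scale)
    also have "\<dots> = map_poly \<phi> (map_poly i ?f)"
      by (rule poly_eqI) (simp add: coeff_map_poly i.zero i'.zero module_hom.zero[OF hom] \<phi>_i del: coeff_add)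
    also have "map_poly i ?f = act E a e"
      by (subst (2) y[of e]) (simp add: lambda_actionD(2,4)[OF D(5)] D(8) generator_action(2)[OF E c(2)]
          I.add I.scale)
    finally show ?thesis .
  qed
  then have "cmod_hom E E' \<phi>" by (simp add: cmod_hom_def hom)
  moreover have "p' (\<phi> e) = p e" for e by (simp add: \<phi>_def p'.add p'.scale D'(12) c'(1))
  ultimately show ?thesis unfolding equiv_ext_def using \<phi>_i by blast
qed

text \<open>The cocycle of the extension in which \<open>c = (0, 1)\<close> satisfies \<open>(\<partial> - \<eta>)c = x\<close>.\<close>

definition cocycle_of :: "'v \<Rightarrow> ('r, 'v, complex) cochain" where
  "cocycle_of x = (\<lambda>w. s [:w:] x, \<lambda>a w. poly_scale s [:[:w:]:] (shift_quot x a))"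

abbreviation twisted :: "'v \<Rightarrow> ('r, 'v \<times> complex) cmod" where
  "twisted x \<equiv> twisted_sum V (one_dim \<eta>) (cocycle_of x)"

lemma module_V_plus_one_dim: "module (mscale (direct_sum V (one_dim \<eta> :: ('r, complex) cmod)))"
  by (rule module_direct_sum[OF s])
    (use conformal_module_one_dim[OF lie, of \<eta>] in \<open>simp add: conformal_module_def\<close>)

lemma twisted_scale:
  shows "mscale (twisted x) = operator_scale (mscale (direct_sum V (one_dim \<eta> :: ('r, complex) cmod)))
      (\<lambda>(v, w). (s del v + s [:w:] x, \<eta> * w))"
    and "module (mscale (twisted x))"
    and "mscale (twisted x) [:z:] (v, w) = (s [:z:] v, z * w)"
    and "mscale (twisted x) del (v, w) = (s del v + s [:w:] x, \<eta> * w)"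
proof -
  let ?D = "mscale (direct_sum V (one_dim \<eta> :: ('r, complex) cmod))"
  let ?T = "\<lambda>(v, w). (s del v + s [:w:] x, \<eta> * w)"
  show eq: "mscale (twisted x) = operator_scale ?D ?T"
    by (intro ext) (simp add: twisted_sum_def operator_scale_def cocycle_of_def case_prod_unfold)
  have const: "s [:a + b:] y = s [:a:] y + s [:b:] y" for a b y
    using V.scale_left_distrib[of "[:a:]" "[:b:]" y] by simp
  have add: "?T (y + z) = ?T y + ?T z" for y z
    by (simp add: case_prod_unfold V.scale_right_distrib const algebra_simps)
  have comm: "?T (?D [:z:] y) = ?D [:z:] (?T y)" for y z
    by (simp add: case_prod_unfold direct_sum_simps V.scale_right_distrib algebra_simps)
  note T = module_V_plus_one_dim add comm
  show "module (mscale (twisted x))" unfolding eq by (rule module_operator_scale[OF T])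
  show "mscale (twisted x) [:z:] (v, w) = (s [:z:] v, z * w)"
    unfolding eq by (subst operator_scale_const[OF T]) (simp_all add: direct_sum_simps)
  show "mscale (twisted x) del (v, w) = (s del v + s [:w:] x, \<eta> * w)"
    unfolding eq by (subst operator_scale_del[OF T]) simp_all
qed

lemma twisted_incl: "module_hom s (mscale (twisted x)) (\<lambda>v. (v, 0))"
  by (rule module_homI[OF s twisted_scale(2)]) (simp_all add: twisted_scale(3,4))

lemma twisted_root: "mscale (twisted x) root (0, 1) = (x, 0)"
proof -
  interpret T: module "mscale (twisted x)" by (rule twisted_scale(2))
  have "mscale (twisted x) ([:- \<eta>:] + del) (0, 1) = (x, 0)"
    by (simp only: T.scale_left_distrib twisted_scale(3,4)) (simp add: V.scale_one[unfolded one_pCons])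
  then show ?thesis by simp
qed

lemma twisted_act:
  "act (twisted x) a e =
    map_poly (\<lambda>v. (v, 0)) (act V a (fst e) + poly_scale s [:[:snd e:]:] (shift_quot x a))"
proof -
  interpret I: module_hom "poly_scale s" "poly_scale (mscale (twisted x))" "map_poly (\<lambda>v. (v, 0))"
    by (rule module_hom_map_poly) (rule twisted_incl)
  show ?thesis by (simp add: twisted_sum_def direct_sum_simps cocycle_of_def I.add)
qed

text \<open>The pullback construction for \<open>\<theta>(v, w) = (\<partial> - \<eta>)v + wx\<close> and \<open>\<iota>(v) = (v, 0)\<close>.\<close>

lemma extension_twisted:
  assumes "shift_divides x"
  shows "extension R V (one_dim \<eta>) (twisted x) (\<lambda>v. (v, 0)) snd"
proof -
  let ?E = "twisted x" and ?\<theta> = "\<lambda>(v, w). s root v + s [:w:] x"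
  have const: "s [:a + b:] y = s [:a:] y + s [:b:] y" for a b y
    using V.scale_left_distrib[of "[:a:]" "[:b:]" y] by simp
  have W: "conformal_module R (one_dim \<eta>)" by (rule conformal_module_one_dim[OF lie])
  then have mW: "module (mscale (one_dim \<eta> :: ('r, complex) cmod))" by (simp add: conformal_module_def)
  have \<theta>: "module_hom (mscale ?E) s ?\<theta>"
  proof (rule module_homI[OF twisted_scale(2) s])
    show "?\<theta> (mscale ?E del e) = s del (?\<theta> e)" for e
    proof (cases e)
      case (Pair v w)
      have "s [:\<eta> * w:] x + s root (s [:w:] x) = s ([:\<eta> * w:] + root * [:w:]) x"
        by (simp only: V.scale_left_distrib V.scale_scale)
      also have "[:\<eta> * w:] + root * [:w:] = del * [:w:]" by simp
      finally have "s [:\<eta> * w:] x + s root (s [:w:] x) = s del (s [:w:] x)"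
        by (simp only: V.scale_scale)
      moreover have "s root (s del v) = s del (s root v)" by (rule V.scale_left_commute)
      ultimately show ?thesis
        by (simp add: Pair twisted_scale(3,4) V.scale_right_distrib add_ac del: V.scale_scale)
    qed
    show "?\<theta> (mscale ?E [:z:] e) = s [:z:] (?\<theta> e)" for z e
      by (cases e) (simp add: twisted_scale(3,4) V.scale_right_distrib algebra_simps)
  qed (auto simp: V.scale_right_distrib const)
  have la: "lambda_action (lscale R) (bracket R) (mscale ?E)
      (\<lambda>a e. map_poly (\<lambda>v. (v, 0)) (act V a (fst e) + poly_scale s [:[:snd e:]:] (shift_quot x a)))"
  proof (rule lambda_action_pullback[OF act_V s torsion_free twisted_incl \<theta>, of "- \<eta>"])
    show "poly_scale s shift (act V a (fst e) + poly_scale s [:[:snd e:]:] (shift_quot x a)) = act V a (?\<theta> e)"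
      for a e
      by (cases e) (simp only: prod.case fst_conv snd_conv P.scale_right_distrib lambda_actionD[OF act_V]
          P.scale_left_commute[of shift] shift_quot_spec[OF assms] lambda_action_linear[OF act_V s])
  qed simp_all
  have "conformal_module R ?E"
    using la by (simp add: conformal_module_def lie twisted_scale(2) twisted_act[abs_def])
  moreover have "module_hom (mscale ?E) (mscale (one_dim \<eta> :: ('r, complex) cmod)) snd"
    by (rule module_homI[OF twisted_scale(2) mW]) (auto simp: twisted_scale(3,4))
  moreover have "0 = map_poly snd (act ?E a e)" for a e
    by (rule poly_eqI) (simp add: twisted_act coeff_map_poly zero_prod_def)
  moreover have "act ?E a (v, 0) = map_poly (\<lambda>v. (v, 0)) (act V a v)" for a v
    by (simp add: twisted_act)
  ultimately show ?thesis
    using conformal W twisted_incl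
    by (auto simp: extension_def cmod_hom_def inj_on_def surj_def image_iff)
qed

text \<open>Makes the trivial extension an instance of the twisted ones, so that it too is an extension.\<close>

lemma twisted_zero: "twisted 0 = direct_sum V (one_dim \<eta>)"
proof -
  let ?D = "direct_sum V (one_dim \<eta> :: ('r, complex) cmod)"
  interpret D: module "mscale ?D" by (rule module_V_plus_one_dim)
  have "module_hom (mscale (twisted 0)) (mscale ?D) id"
    by (rule module_homI[OF twisted_scale(2) module_V_plus_one_dim])
      (auto simp: twisted_scale(3,4) direct_sum_simps)
  then have "mscale (twisted 0) = mscale ?D"
    using module_hom.scale by (intro ext) fastforce
  moreover have "act (twisted 0) = act ?D"
    by (intro ext) (simp add: twisted_act direct_sum_simps shift_quot_zero)
  ultimately show ?thesis by (intro cmod.equality) simp_all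
qed

lemma extension_direct_sum:
  "extension R V (one_dim \<eta>) (direct_sum V (one_dim \<eta>)) (\<lambda>v. (v, 0)) snd"
  using extension_twisted[OF shift_divides_zero] by (simp add: twisted_zero)

text \<open>A splitting amounts to a preimage of \<open>c\<^sub>\<eta>\<close> that \<open>\<partial> - \<eta>\<close> annihilates: it spans a complement of
  \<open>V\<close>, since \<open>a\<^sub>\<lambda>c = 0\<close> is then automatic.\<close>

lemma trivial_ext_iff:
  assumes E: "extension R V (one_dim \<eta>) E i p"
  shows "trivial_ext V (one_dim \<eta>) E i p \<longleftrightarrow> (\<exists>c. p c = 1 \<and> mscale E root c = 0)"
proof
  note D = extensionD[OF E]
  let ?D = "direct_sum V (one_dim \<eta> :: ('r, complex) cmod)"
  interpret i: module_hom s "mscale E" i by (rule D(6))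
  interpret p: module_hom "mscale E" "mscale (one_dim \<eta> :: ('r, complex) cmod)" p by (rule D(7))
  {
    assume "trivial_ext V (one_dim \<eta>) E i p"
    then obtain \<phi> where \<phi>: "cmod_hom E ?D \<phi>" "\<And>v. \<phi> (i v) = (v, 0)" "\<And>e. snd (\<phi> e) = p e"
      unfolding trivial_ext_def equiv_ext_def by blast
    then interpret \<phi>: module_hom "mscale E" "mscale ?D" \<phi> by (simp add: cmod_hom_def)
    obtain c0 where c0: "p c0 = 1" using D(11) by (metis surj_def)
    define c where "c = c0 - i (fst (\<phi> c0))"
    have "\<phi> c = (0, 1)"
      using \<phi>(3)[of c0] by (simp add: c_def \<phi>.diff \<phi>(2) c0 prod_eq_iff)
    moreover obtain x where x: "mscale E root c = i x" by (rule root_generator[OF E])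
    ultimately have "(x, 0) = mscale ?D root (0, 1)"
      using \<phi>.scale[of root c] \<phi>(2)[of x] by simp
    then have "x = 0" by (simp add: direct_sum_simps)
    then show "\<exists>c. p c = 1 \<and> mscale E root c = 0"
      using x by (intro exI[of _ c]) (simp add: c_def p.diff c0 D(12))
  }
  assume "\<exists>c. p c = 1 \<and> mscale E root c = 0"
  then obtain c where "p c = 1" "mscale E root c = i 0" by auto
  then show "trivial_ext V (one_dim \<eta>) E i p"
    unfolding trivial_ext_def
    by (rule equiv_ext_of_generators[OF E extension_direct_sum, where c' = "(0, 1)"])
      (simp_all add: direct_sum_simps)
qed

text \<open>All preimages of \<open>c\<^sub>\<eta>\<close> are of the form \<open>c - y\<close> with \<open>y\<close> in \<open>V\<close>, and passing from \<open>c\<close> to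
  \<open>c - y\<close> subtracts \<open>(\<partial> - \<eta>)y\<close> from \<open>x\<close>.\<close>

lemma trivial_ext_iff_root:
  assumes E: "extension R V (one_dim \<eta>) E i p" and c: "p c = 1" "mscale E root c = i x"
  shows "trivial_ext V (one_dim \<eta>) E i p \<longleftrightarrow> x \<in> range (s root)"
proof -
  note D = extensionD[OF E]
  interpret i: module_hom s "mscale E" i by (rule D(6))
  interpret p: module_hom "mscale E" "mscale (one_dim \<eta> :: ('r, complex) cmod)" p by (rule D(7))
  have change: "mscale E root (c - i y) = i (x - s root y)" for y
    by (simp add: i.m2.scale_right_diff_distrib c(2) i.diff i.scale)
  have "(\<exists>c'. p c' = 1 \<and> mscale E root c' = 0) \<longleftrightarrow> (\<exists>y. mscale E root (c - i y) = 0)"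
  proof
    assume "\<exists>c'. p c' = 1 \<and> mscale E root c' = 0"
    then obtain c' where c': "p c' = 1" "mscale E root c' = 0" by blast
    have "p (c - c') = 0" by (simp add: p.diff c c')
    then obtain y where "c - c' = i y" using D(13) by blast
    then have "c' = c - i y" by (simp add: algebra_simps)
    then show "\<exists>y. mscale E root (c - i y) = 0" using c' by blast
  next
    assume "\<exists>y. mscale E root (c - i y) = 0"
    then show "\<exists>c'. p c' = 1 \<and> mscale E root c' = 0"
      by (metis p.diff c(1) D(12) diff_zero)
  qed
  also have "\<dots> \<longleftrightarrow> x \<in> range (s root)"
  proof -
    have "i z = 0 \<longleftrightarrow> z = 0" for z using D(10) i.zero by (metis injD)
    then show ?thesis by (simp only: change image_iff right_minus_eq UNIV_I) simp
  qed
  finally show ?thesis by (simp add: trivial_ext_iff[OF E])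
qed

text \<open>A cochain carries data for all \<open>w\<close> in \<open>\<complex>\<close>; since \<open>\<partial>\<close> and \<open>a\<^sub>\<lambda>\<close> commute with constants, the
  value at \<open>w = 1\<close> determines the rest, and there the cocycle is determined by \<open>x\<close> alone.\<close>

lemma cocycles_eq: "cocycles R V (one_dim \<eta>) = cocycle_of ` {x. shift_divides x}"
proof (intro equalityI subsetI)
  fix u assume "u \<in> cocycles R V (one_dim \<eta>)"
  then have E: "extension R V (one_dim \<eta>) (twisted_sum V (one_dim \<eta>) u) (\<lambda>v. (v, 0)) snd"
    (is "extension _ _ _ ?E _ _") by (simp add: cocycles_def)
  note D = extensionD[OF E]
  interpret E: module "mscale ?E" by (rule D)
  interpret I: module_hom "poly_scale s" "poly_scale (mscale ?E)" "map_poly (\<lambda>v. (v, 0))"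
    by (rule module_hom_map_poly) (rule D(6))
  have const: "mscale ?E [:z:] e = (s [:z:] (fst e), z * snd e)" for z e
    by (simp add: twisted_sum_def direct_sum_simps)
  have del: "mscale ?E del e = (s del (fst e) + fst u (snd e), \<eta> * snd e)" for e
    by (simp add: twisted_sum_def direct_sum_simps case_prod_unfold V.scale_one[unfolded one_pCons])
  \<comment> \<open>Constants commute with \<open>\<partial>\<close> on \<open>E\<close> only if \<open>fst u\<close> is homogeneous.\<close>
  have fst_linear: "fst u w = s [:w:] (fst u 1)" for w
    using E.scale_left_commute[of del "[:w:]" "(0, 1)"] by (simp add: const del)
  have act0: "act ?E a (0, w) = map_poly (\<lambda>v. (v, 0)) (snd u a w)" for a w
    by (simp add: twisted_sum_def direct_sum_simps lambda_action_zero[OF act_V])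
  have snd_linear: "snd u a w = poly_scale s [:[:w:]:] (snd u a 1)" for a w
    using lambda_actionD(4)[OF D(5), of a w "(0, 1)"] inj_map_poly[OF D(6,10)]
    by (simp add: const act0 I.scale[symmetric] inj_eq)
  have "mscale ?E ([:- \<eta>:] + del) (0, 1) = (fst u 1, 0)"
    by (simp only: E.scale_left_distrib const del) simp
  then have root: "mscale ?E root (0, 1) = (fst u 1, 0)" by simp
  have shift_quot: "snd u a 1 = shift_quot (fst u 1) a" for a
    using generator_action(2)[OF E root, of a] inj_map_poly[OF D(6,10)] by (simp add: act0 inj_eq)
  have "snd u = snd (cocycle_of (fst u 1))"
    by (intro ext) (simp add: cocycle_of_def snd_linear[symmetric] shift_quot[symmetric])
  moreover have "fst u = fst (cocycle_of (fst u 1))"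
    by (intro ext) (simp add: cocycle_of_def fst_linear[symmetric])
  ultimately have "u = cocycle_of (fst u 1)" by (rule prod_eqI[rotated])
  then show "u \<in> cocycle_of ` {x. shift_divides x}"
    using generator_action(1)[OF E root] by blast
next
  fix u assume "u \<in> cocycle_of ` {x. shift_divides x}"
  then show "u \<in> cocycles R V (one_dim \<eta>)"
    using extension_twisted by (auto simp: cocycles_def)
qed

lemma trivial_cocycles_eq: "trivial_cocycles R V (one_dim \<eta>) = cocycle_of ` {x \<in> range (s root). shift_divides x}"
  unfolding trivial_cocycles_def cocycles_eq
  using trivial_ext_iff_root[OF extension_twisted, where c = "(0, 1)"] twisted_root by auto

end

section \<open>Extensions by a free module of rank one\<close>

lemma free_basis_singletonD:
  assumes "module s" and "free_basis s {v}"
  shows "s q v = 0 \<Longrightarrow> q = 0" and "\<exists>q. x = s q v"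
proof -
  interpret module s by fact
  show "q = 0" if "s q v = 0"
  proof (rule ccontr)
    assume "q \<noteq> 0"
    then have "dependent {v}"
      using that unfolding dependent_explicit by (intro exI[of _ "{v}"] exI[of _ "\<lambda>_. q"]) simp
    then show False using assms(2) by (simp add: free_basis_def)
  qed
  show "\<exists>q. x = s q v"
    using assms(2) span_singleton[of v] by (auto simp: free_basis_def image_iff)
qed

lemma free_rank_one_torsion_free:
  assumes "module s" and "free_basis s {v}" and "s q x = 0"
  shows "q = 0 \<or> x = 0"
proof -
  interpret module s by fact
  obtain r where x: "x = s r v" using free_basis_singletonD(2)[OF assms(1,2)] by blast
  then have "q * r = 0" using assms(3) free_basis_singletonD(1)[OF assms(1,2), of "q * r"] by simp
  then show ?thesis using x by auto
qed

text \<open>Substitute the root \<open>\<lambda> = \<eta> - \<partial>\<close> of the left factor and compare coefficients of \<open>\<partial>\<close>.\<close>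

lemma shift_dvd_vir_poly:
  assumes "[:[:- \<eta>, 1:], 1:] * F = [:[:t:]:] * vir_poly 1 \<alpha> \<beta>" and "t \<noteq> 0"
  shows "\<alpha> = 1 \<and> \<beta> + \<eta> = 0"
proof -
  have "poly ([:[:- \<eta>, 1:], 1:] * F) [:\<eta>, -1:] = 0" by simp
  moreover have "poly ([:[:t:]:] * vir_poly 1 \<alpha> \<beta>) [:\<eta>, -1:] =
      [:t:] * (del + [:\<eta>, -1:] * [:\<alpha>:] + [:\<beta>:])"
    by (simp add: one_pCons algebra_simps)
  ultimately have "[:t:] * (del + [:\<eta>, -1:] * [:\<alpha>:] + [:\<beta>:]) = 0"
    by (simp only: assms(1))
  then have "[:t:] = 0 \<or> del + [:\<eta>, -1:] * [:\<alpha>:] + [:\<beta>:] = 0" by (simp only: mult_eq_0_iff)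
  then have "\<alpha> = 1" "\<eta> * \<alpha> + \<beta> = 0" using assms(2) by (auto simp: algebra_simps)
  then show ?thesis by (simp add: add.commute)
qed

lemma vector_space_cochain_scale:
  assumes "module (mscale V)"
  shows "vector_space (cochain_scale V)"
proof -
  interpret V: module "mscale V" by fact
  interpret P: module "poly_scale (mscale V)" by (rule module_poly_scale) fact
  have "mscale V [:a + b:] x = mscale V [:a:] x + mscale V [:b:] x" for a b x
    using V.scale_left_distrib[of "[:a:]" "[:b:]" x] by simp
  moreover have "poly_scale (mscale V) [:[:a + b:]:] x =
      poly_scale (mscale V) [:[:a:]:] x + poly_scale (mscale V) [:[:b:]:] x" for a b x
    using P.scale_left_distrib[of "[:[:a:]:]" "[:[:b:]:]" x] by simp
  ultimately show ?thesis
    by unfold_locales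
      (auto intro!: prod_eqI simp: cochain_scale_def fun_eq_iff V.scale_right_distrib
        P.scale_right_distrib mult.commute V.scale_one[unfolded one_pCons]
        P.scale_one[unfolded one_pCons])
qed

locale free_rank_one_cmod =
  fixes R :: "'r::ab_group_add lca" and V :: "('r, 'v::ab_group_add) cmod" and v :: 'v
    and \<eta> :: complex
  assumes conformal: "conformal_module R V" and basis: "free_basis (mscale V) {v}"
begin

sublocale torsion_free_cmod R V \<eta>
  using conformal free_rank_one_torsion_free[OF _ basis]
  by unfold_locales (auto simp: conformal_module_def)

lemma scale_v_eq_iff: "s q v = s r v \<longleftrightarrow> q = r"
proof
  assume "s q v = s r v"
  then have "s (q - r) v = 0" by (simp add: V.scale_left_diff_distrib)
  then show "q = r" using free_basis_singletonD(1)[OF s basis, of "q - r"] by simp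
qed simp

lemma obtain_coeff: obtains q where "x = s q v"
  using free_basis_singletonD(2)[OF s basis] by blast

lemma obtain_poly_coeff: obtains F where "p = poly_scale s F [:v:]"
proof -
  have "\<exists>F. p = poly_scale s F [:v:]"
  proof (induction p)
    case 0
    show ?case by (intro exI[of _ 0]) simp
  next
    case (pCons x p)
    then obtain F where F: "p = poly_scale s F [:v:]" by blast
    obtain q where "x = s q v" by (rule obtain_coeff)
    then have "pCons x p = poly_scale s (pCons q F) [:v:]"
      by (simp add: poly_scale_pCons_left[OF s] F map_poly_pCons)
    then show ?case by blast
  qed
  then show thesis using that by blast
qed

lemma poly_scale_v_cancel: "poly_scale s F [:v:] = poly_scale s G [:v:] \<Longrightarrow> F = G"
proof -
  assume "poly_scale s F [:v:] = poly_scale s G [:v:]"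
  then have "poly_scale s (F - G) [:v:] = 0" by (simp add: P.scale_left_diff_distrib)
  then have "F - G = 0 \<or> [:v:] = 0" 
    using poly_scale_torsion_free[OF s torsion_free] by fastforce
  moreover have "v \<noteq> 0" using free_basis_singletonD(1)[OF s basis, of 1] by auto
  ultimately show "F = G" by simp
qed

text \<open>Division by \<open>\<partial> - \<eta>\<close> leaves the value at \<open>\<eta>\<close> as remainder.\<close>

lemma coeff_remainder: obtains q' where "s q v = s [:poly q \<eta>:] v + s root (s q' v)"
proof -
  have "root dvd q - [:poly q \<eta>:]" by (simp add: poly_eq_0_iff_dvd[symmetric])
  then obtain q' where "q = [:poly q \<eta>:] + root * q'" by (auto simp: dvd_def algebra_simps)
  then have "s q v = s [:poly q \<eta>:] v + s (root * q') v"
    using V.scale_left_distrib[of "[:poly q \<eta>:]" "root * q'" v] by simp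
  then show thesis using that[of q'] by simp
qed

text \<open>With \<open>coeff_remainder\<close>, this says that the multiples of \<open>v\<close> by constants represent
  \<open>V/(\<partial> - \<eta>)V\<close>.\<close>

lemma const_in_range_root_iff: "s [:t:] v \<in> range (s root) \<longleftrightarrow> t = 0"
proof
  assume "s [:t:] v \<in> range (s root)"
  then obtain x where x: "s [:t:] v = s root x" by blast
  obtain q where "x = s q v" by (rule obtain_coeff)
  then have "s [:t:] v = s (root * q) v" using x by simp
  then have "[:t:] = root * q" by (simp only: scale_v_eq_iff)
  then have "poly [:t:] \<eta> = poly (root * q) \<eta>" by (simp only:)
  then show "t = 0" by simp
next
  assume "t = 0"
  then show "s [:t:] v \<in> range (s root)" by (auto intro: range_eqI[of _ _ 0])
qed

text \<open>Correcting \<open>c\<close> by an element of \<open>V\<close> replaces \<open>x\<close> by its remainder modulo \<open>\<partial> - \<eta>\<close>.\<close>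

lemma obtain_generator:
  assumes "extension R V (one_dim \<eta>) E i p"
  obtains c t where "p c = 1" and "mscale E root c = i (s [:t:] v)"
proof -
  note D = extensionD[OF assms]
  interpret i: module_hom s "mscale E" i by (rule D(6))
  interpret p: module_hom "mscale E" "mscale (one_dim \<eta> :: ('r, complex) cmod)" p by (rule D(7))
  obtain c where c: "p c = 1" using D(11) by (metis surj_def)
  obtain x where x: "mscale E root c = i x" by (rule root_generator[OF assms])
  obtain q where q: "x = s q v" by (rule obtain_coeff)
  obtain q' where q': "s q v = s [:poly q \<eta>:] v + s root (s q' v)" by (rule coeff_remainder)
  have "mscale E root (c - i (s q' v)) = i (s [:poly q \<eta>:] v)"
    by (simp add: i.m2.scale_right_diff_distrib x q q' i.add i.scale del: V.scale_scale)
  moreover have "p (c - i (s q' v)) = 1" by (simp add: p.diff c D(12))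
  ultimately show thesis using that by blast
qed

lemma standard_form_of_generator:
  assumes E: "extension R V (one_dim \<eta>) E i p" and c: "p c = 1" "mscale E root c = i (s h v)"
    and A: "act V A v = poly_scale s (vir_poly d1 \<alpha>1 \<beta>1) [:v:]"
    and B: "act V B v = poly_scale s (vir_poly d2 \<alpha>2 \<beta>2) [:v:]"
    and f: "shift_quot (s h v) A = poly_scale s f [:v:]" and g: "shift_quot (s h v) B = poly_scale s g [:v:]"
  shows "standard_form A B d1 d2 \<alpha>1 \<alpha>2 \<beta>1 \<beta>2 \<eta> E (i v) c f g h"
proof -
  note D = extensionD[OF E]
  interpret i: module_hom s "mscale E" i by (rule D(6))
  interpret p: module_hom "mscale E" "mscale (one_dim \<eta> :: ('r, complex) cmod)" p by (rule D(7))
  interpret I: module_hom "poly_scale s" "poly_scale (mscale E)" "map_poly i"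
    by (rule module_hom_map_poly) (rule D(6))
  have v: "map_poly i [:v:] = [:i v:]" by (simp add: map_poly_pCons i.zero)
  let ?b = "\<lambda>(q, z). mscale E q (i v) + mscale E [:z:] c"
  have p_b: "p (?b (q, z)) = z" for q z by (simp add: p.add p.scale c D(12))
  have "inj ?b"
  proof (rule injI)
    fix y y' assume eq: "?b y = ?b y'"
    obtain q z q' z' where y: "y = (q, z)" "y' = (q', z')" by fastforce
    have "z = z'" using p_b[of q z] p_b[of q' z'] eq unfolding y by metis
    then have "i (s q v) = i (s q' v)" using eq by (simp add: y i.scale)
    then have "q = q'" using D(10) scale_v_eq_iff by (metis injD)
    then show "y = y'" using \<open>z = z'\<close> y by simp
  qed
  moreover have "surj ?b"
  proof (rule surjI)
    fix e
    define q where "q = (SOME q. e = i (s q v) + mscale E [:p e:] c)"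
    have "\<exists>q. e = i (s q v) + mscale E [:p e:] c"
      by (metis extension_decomposition[OF E c(1)] obtain_coeff)
    then have "e = i (s q v) + mscale E [:p e:] c" unfolding q_def by (rule someI_ex)
    then show "?b ((\<lambda>e. (SOME q. e = i (s q v) + mscale E [:p e:] c, p e)) e) = e"
      by (simp add: i.scale q_def)
  qed
  ultimately have "bij ?b" by (simp add: bij_def)
  then show ?thesis
    unfolding standard_form_def
    using scale_generator[OF E c(2)]
    by (simp only: D(8) A B generator_action(2)[OF E c(2)] f g I.scale v i.scale simp_thms)
qed

lemma generator_of_standard_form:
  assumes E: "extension R V (one_dim \<eta>) E i p"
    and std: "standard_form A B d1 d2 \<alpha>1 \<alpha>2 \<beta>1 \<beta>2 \<eta> E (i v) c f g h"
  shows "mscale E root c = i (s h v)"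
proof -
  note D = extensionD[OF E]
  interpret i: module_hom s "mscale E" i by (rule D(6))
  have "mscale E (del - [:\<eta>:]) c = i (s h v)"
    using std by (simp only: standard_form_def i.m2.scale_left_diff_distrib i.scale) simp
  then show ?thesis by simp
qed

lemma nontrivial_if_constant:
  assumes "extension R V (one_dim \<eta>) E i p" and "p c = 1"
    and "standard_form A B d1 d2 \<alpha>1 \<alpha>2 \<beta>1 \<beta>2 \<eta> E (i v) c f g [:t:]" and "t \<noteq> 0"
  shows "\<not> trivial_ext V (one_dim \<eta>) E i p"
  using trivial_ext_iff_root[OF assms(1,2) generator_of_standard_form[OF assms(1,3)]] assms(4)
  by (simp add: const_in_range_root_iff)

lemma standard_form_exists:
  assumes E: "extension R V (one_dim \<eta>) E i p"
    and A: "act V A v = poly_scale s (vir_poly d1 \<alpha>1 \<beta>1) [:v:]"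
    and B: "act V B v = poly_scale s (vir_poly d2 \<alpha>2 \<beta>2) [:v:]"
  shows "\<exists>c f g h. p c = 1 \<and> standard_form A B d1 d2 \<alpha>1 \<alpha>2 \<beta>1 \<beta>2 \<eta> E (i v) c f g h"
proof -
  obtain c t where c: "p c = 1" "mscale E root c = i (s [:t:] v)" by (rule obtain_generator[OF E])
  obtain f where "shift_quot (s [:t:] v) A = poly_scale s f [:v:]" by (rule obtain_poly_coeff)
  moreover obtain g where "shift_quot (s [:t:] v) B = poly_scale s g [:v:]" by (rule obtain_poly_coeff)
  ultimately show ?thesis using standard_form_of_generator[OF E c A B] c(1) by blast
qed

lemma shift_divides_const_condition:
  assumes "shift_divides (s [:t:] v)" and "t \<noteq> 0"
    and A: "act V a v = poly_scale s (vir_poly 1 \<alpha> \<beta>) [:v:]"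
  shows "\<alpha> = 1 \<and> \<beta> + \<eta> = 0"
proof -
  obtain f where f: "poly_scale s shift f = act V a (s [:t:] v)"
    using assms(1) unfolding shift_divides_def by blast
  obtain F where "f = poly_scale s F [:v:]" by (rule obtain_poly_coeff)
  then have "poly_scale s (shift * F) [:v:] = poly_scale s ([:[:t:]:] * vir_poly 1 \<alpha> \<beta>) [:v:]"
    using f by (simp only: lambda_actionD(4)[OF act_V] A P.scale_scale)
  then show ?thesis using shift_dvd_vir_poly assms(2) poly_scale_v_cancel by blast
qed

lemma nontrivial_generator:
  assumes E: "extension R V (one_dim \<eta>) E i p" and "\<not> trivial_ext V (one_dim \<eta>) E i p"
  obtains c t where "p c = 1" and "mscale E root c = i (s [:t:] v)" and "t \<noteq> 0"
proof -
  obtain c t where c: "p c = 1" "mscale E root c = i (s [:t:] v)" by (rule obtain_generator[OF E])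
  then have "t \<noteq> 0" using assms(2) trivial_ext_iff_root[OF E c] const_in_range_root_iff by blast
  then show thesis using that c by blast
qed

lemma nontrivial_condition:
  assumes E: "extension R V (one_dim \<eta>) E i p" and "\<not> trivial_ext V (one_dim \<eta>) E i p"
    and A: "act V a v = poly_scale s (vir_poly 1 \<alpha> \<beta>) [:v:]"
  shows "\<alpha> = 1 \<and> \<beta> + \<eta> = 0"
proof -
  obtain c t where "p c = 1" "mscale E root c = i (s [:t:] v)" "t \<noteq> 0"
    by (rule nontrivial_generator[OF assms(1,2)])
  then show ?thesis using shift_divides_const_condition generator_action(1)[OF E] A by blast
qed

text \<open>The elements with this property form a \<open>\<complex>[\<partial>]\<close>-submodule, because the quotients behave like an
  action.\<close>

lemma shift_divides_all:
  assumes "shift_divides v"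
  shows "shift_divides x"
proof -
  obtain q where x: "x = s q v" by (rule obtain_coeff)
  have "s q v \<in> {x. shift_divides x}"
  proof (rule scale_mem[OF s]; unfold mem_Collect_eq)
    fix x y assume x: "shift_divides x" and y: "shift_divides y"
    show "shift_divides (x + y)" unfolding shift_divides_def
      by (intro allI exI[of _ "shift_quot x _ + shift_quot y _"])
        (simp only: P.scale_right_distrib shift_quot_spec x y lambda_actionD[OF act_V])
  next
    fix x z assume x: "shift_divides x"
    show "shift_divides (s [:z:] x)" unfolding shift_divides_def
      by (intro allI exI[of _ "poly_scale s [:[:z:]:] (shift_quot x _)"])
        (simp only: P.scale_left_commute[of shift] shift_quot_spec x lambda_actionD[OF act_V])
  next
    fix x assume x: "shift_divides x"
    show "shift_divides (s del x)" unfolding shift_divides_def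
      by (intro allI exI[of _ "poly_scale s (del1 + lam1) (shift_quot x _)"])
        (simp only: P.scale_left_commute[of shift] shift_quot_spec x lambda_actionD[OF act_V])
  qed (rule assms)
  then show ?thesis by (simp add: x)
qed

text \<open>For fixed \<open>v\<close>, divisibility of \<open>a\<^sub>\<lambda>v\<close> is a condition on \<open>a\<close> that is stable under \<open>\<complex>[\<partial>]\<close>, so it
  passes from \<open>A\<close> and \<open>B\<close> to all of \<open>\<R>\<close>.\<close>

lemma shift_divides_generator:
  assumes "module (lscale R)" and "module.span (lscale R) {A, B} = UNIV"
    and A: "act V A v = poly_scale s shift f" and B: "act V B v = poly_scale s shift g"
  shows "shift_divides v"
proof -
  interpret R: module "lscale R" by fact
  let ?S = "{a. \<exists>f. poly_scale s shift f = act V a v}"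
  have add: "a + b \<in> ?S" if ab: "a \<in> ?S" "b \<in> ?S" for a b
  proof -
    obtain f g where "poly_scale s shift f = act V a v" "poly_scale s shift g = act V b v"
      using ab by blast
    then have "poly_scale s shift (f + g) = act V (a + b) v"
      by (simp only: lambda_actionD(1)[OF act_V] P.scale_right_distrib)
    then show ?thesis by blast
  qed
  have scale: "lscale R q a \<in> ?S" if "a \<in> ?S" for q a
  proof (rule scale_mem[OF assms(1) that add])
    show "lscale R [:z:] b \<in> ?S" if b: "b \<in> ?S" for z b
    proof -
      obtain f where "poly_scale s shift f = act V b v" using b by blast
      then have "poly_scale s shift (poly_scale s [:[:z:]:] f) = act V (lscale R [:z:] b) v"
        by (simp only: lambda_actionD(3)[OF act_V] P.scale_left_commute[of shift])
      then show ?thesis by blast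
    qed
    show "lscale R del b \<in> ?S" if b: "b \<in> ?S" for b
    proof -
      obtain f where "poly_scale s shift f = act V b v" using b by blast
      then have "poly_scale s shift (poly_scale s (- lam1) f) = act V (lscale R del b) v"
        by (simp only: lambda_actionD(5)[OF act_V] P.scale_left_commute[of shift])
      then show ?thesis by blast
    qed
  qed
  have "0 \<in> ?S" using shift_divides_zero lambda_action_zero[OF act_V] by (auto intro!: exI[of _ 0])
  then have "R.subspace ?S" using add scale unfolding R.subspace_def by blast
  moreover have "{A, B} \<subseteq> ?S" using A B by force
  ultimately have "R.span {A, B} \<subseteq> ?S" by (intro R.span_minimal)
  then show ?thesis using assms(2) by (auto simp: shift_divides_def)
qed

context
  assumes v: "shift_divides v"
begin

lemma shift_quot_spec_all: "poly_scale s shift (shift_quot x a) = act V a x"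
  by (rule shift_quot_spec[OF shift_divides_all[OF v]])

lemma cocycle_of_add: "cocycle_of (x + y) = cocycle_of x + cocycle_of y"
proof -
  have "shift_quot (x + y) a = shift_quot x a + shift_quot y a" for a
    by (rule shift_quot_eq) (simp only: P.scale_right_distrib shift_quot_spec_all lambda_actionD(2)[OF act_V])
  then show ?thesis
    by (auto intro!: prod_eqI simp: cocycle_of_def fun_eq_iff V.scale_right_distrib P.scale_right_distrib)
qed

lemma cocycle_of_scale: "cocycle_of (s [:z:] x) = cochain_scale V z (cocycle_of x)"
proof -
  have "shift_quot (s [:z:] x) a = poly_scale s [:[:z:]:] (shift_quot x a)" for a
    by (rule shift_quot_eq)
      (simp only: P.scale_left_commute[of shift] shift_quot_spec_all lambda_actionD(4)[OF act_V])
  then show ?thesis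
    by (auto intro!: prod_eqI simp: cocycle_of_def cochain_scale_def fun_eq_iff mult.commute)
qed

lemma inj_cocycle_of: "cocycle_of x = cocycle_of y \<Longrightarrow> x = y"
proof -
  assume "cocycle_of x = cocycle_of y"
  then have "fst (cocycle_of x) 1 = fst (cocycle_of y) 1" by simp
  then show "x = y" by (simp add: cocycle_of_def V.scale_one[unfolded one_pCons])
qed

text \<open>When the divisibility condition holds on all of \<open>V\<close>, \<^const>\<open>cocycle_of\<close> is a linear bijection from \<open>V\<close> to the cocycles
  that maps \<open>(\<partial> - \<eta>)V\<close> to the trivial ones; the class of \<open>v\<close> is a basis of the quotient.\<close>

lemma ext_dim_one: "ext_dim R (one_dim \<eta> :: ('r, complex) cmod) V 1"
proof -
  let ?sc = "cochain_scale V :: complex \<Rightarrow> ('r, 'v, complex) cochain \<Rightarrow> _"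
  let ?Z = "cocycles R V (one_dim \<eta> :: ('r, complex) cmod)"
  let ?B = "trivial_cocycles R V (one_dim \<eta> :: ('r, complex) cmod)"
  have Z: "?Z = range cocycle_of" by (auto simp: cocycles_eq shift_divides_all[OF v])
  have B: "?B = cocycle_of ` range (s root)" by (auto simp: trivial_cocycles_eq shift_divides_all[OF v])
  have vs: "vector_space ?sc" by (rule vector_space_cochain_scale[OF s])
  interpret C: vector_space ?sc by (rule vs)
  have sub: "module.subspace ?sc (cocycle_of ` X)"
    if "0 \<in> X" "\<And>x y. x \<in> X \<Longrightarrow> y \<in> X \<Longrightarrow> x + y \<in> X" "\<And>z x. x \<in> X \<Longrightarrow> s [:z:] x \<in> X" for X
    unfolding C.subspace_def
  proof (intro conjI ballI allI)
    have "cocycle_of 0 = 0" using cocycle_of_add[of 0 0] by simp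
    then show "0 \<in> cocycle_of ` X" using that(1) by force
  next
    fix x y assume "x \<in> cocycle_of ` X" "y \<in> cocycle_of ` X"
    then show "x + y \<in> cocycle_of ` X" 
      by (auto simp: cocycle_of_add[symmetric] intro!: imageI that(2))
  next
    fix z x assume "x \<in> cocycle_of ` X"
    then show "?sc z x \<in> cocycle_of ` X" 
      by (auto simp: cocycle_of_scale[symmetric] intro!: imageI that(3))
  qed
  have subB: "module.subspace ?sc ?B" unfolding B
  proof (rule sub)
    show "0 \<in> range (s root)" by (rule range_eqI[of _ _ 0]) simp
    show "x + y \<in> range (s root)" if "x \<in> range (s root)" "y \<in> range (s root)" for x y
      using that by (auto simp: V.scale_right_distrib[symmetric])
    show "s [:z:] x \<in> range (s root)" if "x \<in> range (s root)" for z x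
      using that by (metis V.scale_left_commute imageE rangeI)
  qed
  have subZ: "module.subspace ?sc ?Z" unfolding Z by (rule sub) auto
  show ?thesis
    unfolding ext_dim_def quotient_dim_def
  proof (intro conjI exI[of _ "{cocycle_of v}"] allI impI ballI)
    fix k x
    assume "(\<Sum>x\<in>{cocycle_of v}. ?sc (k x) x) \<in> ?B" and x: "x \<in> {cocycle_of v}"
    then have "cocycle_of (s [:k x:] v) \<in> cocycle_of ` range (s root)"
      by (simp add: cocycle_of_scale B)
    then have "s [:k x:] v \<in> range (s root)" using inj_cocycle_of by blast
    then show "k x = 0" by (simp only: const_in_range_root_iff)
  next
    fix z assume "z \<in> ?Z"
    then obtain x where x: "z = cocycle_of x" by (auto simp: Z)
    obtain q where q: "x = s q v" by (rule obtain_coeff)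
    obtain q' where q': "s q v = s [:poly q \<eta>:] v + s root (s q' v)" by (rule coeff_remainder)
    have "z - ?sc (poly q \<eta>) (cocycle_of v) = cocycle_of (s root (s q' v))"
      by (simp only: x q q' cocycle_of_add cocycle_of_scale) simp
    then show "\<exists>k. z - (\<Sum>x\<in>{cocycle_of v}. ?sc (k x) x) \<in> ?B"
      by (intro exI[of _ "\<lambda>_. poly q \<eta>"]) (simp add: B del: V.scale_scale)
  qed (use vs subZ subB in \<open>auto simp: Z B\<close>)
qed

lemma constant_extension_exists:
  assumes "t \<noteq> 0"
    and "act V A v = poly_scale s (vir_poly d1 \<alpha>1 \<beta>1) [:v:]"
    and "act V B v = poly_scale s (vir_poly d2 \<alpha>2 \<beta>2) [:v:]"
    and "shift_quot (s [:t:] v) A = poly_scale s f [:v:]" and "shift_quot (s [:t:] v) B = poly_scale s g [:v:]"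
  shows "\<exists>(E' :: ('r, 'v \<times> complex) cmod) i' p' c.
    extension R V (one_dim \<eta>) E' i' p' \<and> \<not> trivial_ext V (one_dim \<eta>) E' i' p' \<and> p' c = 1 \<and>
    standard_form A B d1 d2 \<alpha>1 \<alpha>2 \<beta>1 \<beta>2 \<eta> E' (i' v) c f g [:t:]"
proof -
  note E = extension_twisted[OF shift_divides_all[OF v], of "s [:t:] v"]
  have "standard_form A B d1 d2 \<alpha>1 \<alpha>2 \<beta>1 \<beta>2 \<eta> (twisted (s [:t:] v)) (v, 0) (0, 1) f g [:t:]"
    by (rule standard_form_of_generator[OF E _ twisted_root assms(2-5)]) simp
  then show ?thesis
    using E nontrivial_if_constant[OF E, of "(0, 1)"] assms(1) by (metis snd_conv)
qed

text \<open>The model extension is the twisted sum for \<open>x = tv\<close>, where \<open>t\<close> is the constant to which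
  \<open>(\<partial> - \<eta>)c\<close> was normalised.\<close>

lemma nontrivial_equiv_constant:
  assumes "extension R V (one_dim \<eta>) E i p" and "\<not> trivial_ext V (one_dim \<eta>) E i p"
    and "act V A v = poly_scale s (vir_poly d1 \<alpha>1 \<beta>1) [:v:]"
    and "act V B v = poly_scale s (vir_poly d2 \<alpha>2 \<beta>2) [:v:]"
    and "\<And>t. shift_quot (s [:t:] v) A = poly_scale s (f t) [:v:]"
    and "\<And>t. shift_quot (s [:t:] v) B = poly_scale s (g t) [:v:]"
  shows "\<exists>t (E' :: ('r, 'v \<times> complex) cmod) i' p' c. t \<noteq> 0 \<and>
    extension R V (one_dim \<eta>) E' i' p' \<and> equiv_ext E i p E' i' p' \<and> p' c = 1 \<and>
    standard_form A B d1 d2 \<alpha>1 \<alpha>2 \<beta>1 \<beta>2 \<eta> E' (i' v) c (f t) (g t) [:t:]"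
proof -
  obtain c t where c: "p c = 1" "mscale E root c = i (s [:t:] v)" and t: "t \<noteq> 0"
    by (rule nontrivial_generator[OF assms(1,2)])
  obtain E' :: "('r, 'v \<times> complex) cmod" and i' p' c' where E':
    "extension R V (one_dim \<eta>) E' i' p'" "p' c' = 1"
    "standard_form A B d1 d2 \<alpha>1 \<alpha>2 \<beta>1 \<beta>2 \<eta> E' (i' v) c' (f t) (g t) [:t:]"
    using constant_extension_exists[OF t assms(3-6)] by blast
  then have "equiv_ext E i p E' i' p'"
    using equiv_ext_of_generators[OF assms(1) E'(1) c] generator_of_standard_form by blast
  then show ?thesis using t E' by blast
qed

end

lemma shift_quot_const:
  assumes "act V a v = poly_scale s (vir_poly 1 1 \<beta>) [:v:]" and "\<beta> + \<eta> = 0"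
  shows "shift_quot (s [:t:] v) a = poly_scale s [:[:t:]:] [:v:]"
proof (rule shift_quot_eq)
  have "vir_poly 1 1 \<beta> = shift" using assms(2) by (simp add: eq_neg_iff_add_eq_0)
  then have "act V a v = poly_scale s shift [:v:]" using assms(1) by (simp only:)
  then show "poly_scale s shift (poly_scale s [:[:t:]:] [:v:]) = act V a (s [:t:] v)"
    by (simp only: P.scale_left_commute[of shift] lambda_actionD(4)[OF act_V])
qed

lemma shift_quot_vanishing:
  assumes "act V a v = poly_scale s (vir_poly 0 \<alpha> \<beta>) [:v:]"
  shows "shift_quot (s [:t:] v) a = poly_scale s 0 [:v:]"
  by (rule shift_quot_eq) (use assms in \<open>simp add: lambda_actionD(4)[OF act_V]\<close>)

end

theorem theorem3p4:
  fixes R :: "'r::ab_group_add lca" and A B :: 'r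
    and V :: "('r, 'v::ab_group_add) cmod" and v :: 'v
    and d1 d2 \<alpha>1 \<alpha>2 \<beta>1 \<beta>2 \<eta> :: complex
  assumes "two_virasoro R A B"
    and "rank_one_irreducible R A B d1 d2 \<alpha>1 \<alpha>2 \<beta>1 \<beta>2 V v"
  shows
    "(\<forall>(E :: ('r, 'e::ab_group_add) cmod) i p.
        extension R V (one_dim \<eta>) E i p \<longrightarrow>
        (\<exists>c f g h. p c = 1 \<and> standard_form A B d1 d2 \<alpha>1 \<alpha>2 \<beta>1 \<beta>2 \<eta> E (i v) c f g h)) \<and>
     (\<forall>(E :: ('r, 'e) cmod) i p.
        extension R V (one_dim \<eta>) E i p \<and> \<not> trivial_ext V (one_dim \<eta>) E i p \<longrightarrow>
        (d1 = 1 \<and> \<alpha>1 = 1 \<and> \<beta>1 + \<eta> = 0) \<or> (d2 = 1 \<and> \<alpha>2 = 1 \<and> \<beta>2 + \<eta> = 0)) \<and>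
     ((d1 = 1 \<and> \<alpha>1 = 1 \<and> \<beta>1 + \<eta> = 0) \<or> (d2 = 1 \<and> \<alpha>2 = 1 \<and> \<beta>2 + \<eta> = 0) \<longrightarrow>
        ext_dim R (one_dim \<eta> :: ('r, complex) cmod) V 1) \<and>
     (d1 = 1 \<and> \<alpha>1 = 1 \<and> \<beta>1 + \<eta> = 0 \<longrightarrow>
        d2 = 0 \<and>
        (\<forall>(E :: ('r, 'e) cmod) i p.
          extension R V (one_dim \<eta>) E i p \<and> \<not> trivial_ext V (one_dim \<eta>) E i p \<longrightarrow>
          (\<exists>s (E' :: ('r, 'v \<times> complex) cmod) i' p' c. s \<noteq> 0 \<and>
            extension R V (one_dim \<eta>) E' i' p' \<and> equiv_ext E i p E' i' p' \<and> p' c = 1 \<and>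
            standard_form A B d1 d2 \<alpha>1 \<alpha>2 \<beta>1 \<beta>2 \<eta> E' (i' v) c [:[:s:]:] 0 [:s:])) \<and>
        (\<forall>s. s \<noteq> 0 \<longrightarrow>
          (\<exists>(E' :: ('r, 'v \<times> complex) cmod) i' p' c.
            extension R V (one_dim \<eta>) E' i' p' \<and> \<not> trivial_ext V (one_dim \<eta>) E' i' p' \<and> p' c = 1 \<and>
            standard_form A B d1 d2 \<alpha>1 \<alpha>2 \<beta>1 \<beta>2 \<eta> E' (i' v) c [:[:s:]:] 0 [:s:])) \<and>
        (\<forall>s (E :: ('r, 'e) cmod) i p c. s \<noteq> 0 \<and>
          extension R V (one_dim \<eta>) E i p \<and> p c = 1 \<and>
          standard_form A B d1 d2 \<alpha>1 \<alpha>2 \<beta>1 \<beta>2 \<eta> E (i v) c [:[:s:]:] 0 [:s:] \<longrightarrow>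
          \<not> trivial_ext V (one_dim \<eta>) E i p)) \<and>
     (d2 = 1 \<and> \<alpha>2 = 1 \<and> \<beta>2 + \<eta> = 0 \<longrightarrow>
        d1 = 0 \<and>
        (\<forall>(E :: ('r, 'e) cmod) i p.
          extension R V (one_dim \<eta>) E i p \<and> \<not> trivial_ext V (one_dim \<eta>) E i p \<longrightarrow>
          (\<exists>t (E' :: ('r, 'v \<times> complex) cmod) i' p' c. t \<noteq> 0 \<and>
            extension R V (one_dim \<eta>) E' i' p' \<and> equiv_ext E i p E' i' p' \<and> p' c = 1 \<and>
            standard_form A B d1 d2 \<alpha>1 \<alpha>2 \<beta>1 \<beta>2 \<eta> E' (i' v) c 0 [:[:t:]:] [:t:])) \<and>
        (\<forall>t. t \<noteq> 0 \<longrightarrow>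
          (\<exists>(E' :: ('r, 'v \<times> complex) cmod) i' p' c.
            extension R V (one_dim \<eta>) E' i' p' \<and> \<not> trivial_ext V (one_dim \<eta>) E' i' p' \<and> p' c = 1 \<and>
            standard_form A B d1 d2 \<alpha>1 \<alpha>2 \<beta>1 \<beta>2 \<eta> E' (i' v) c 0 [:[:t:]:] [:t:])) \<and>
        (\<forall>t (E :: ('r, 'e) cmod) i p c. t \<noteq> 0 \<and>
          extension R V (one_dim \<eta>) E i p \<and> p c = 1 \<and>
          standard_form A B d1 d2 \<alpha>1 \<alpha>2 \<beta>1 \<beta>2 \<eta> E (i v) c 0 [:[:t:]:] [:t:] \<longrightarrow>
          \<not> trivial_ext V (one_dim \<eta>) E i p))"
proof -
  have R: "module (lscale R)" and span: "module.span (lscale R) {A, B} = UNIV"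
    using assms(1) by (simp_all add: two_virasoro_def lie_conformal_algebra_def free_basis_def)
  have d: "d1 = 0 \<and> d2 = 1 \<or> d1 = 1 \<and> d2 = 0"
    and conformal: "conformal_module R V" and basis: "free_basis (mscale V) {v}"
    and VA: "act V A v = poly_scale (mscale V) (vir_poly d1 \<alpha>1 \<beta>1) [:v:]"
    and VB: "act V B v = poly_scale (mscale V) (vir_poly d2 \<alpha>2 \<beta>2) [:v:]"
    using assms(2) by (auto simp: rank_one_irreducible_def)
  interpret free_rank_one_cmod R V v \<eta> by unfold_locales (fact conformal, fact basis)
  let ?c1 = "d1 = 1 \<and> \<alpha>1 = 1 \<and> \<beta>1 + \<eta> = 0" and ?c2 = "d2 = 1 \<and> \<alpha>2 = 1 \<and> \<beta>2 + \<eta> = 0"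
  have shift: "vir_poly 1 1 \<beta> = shift" if "\<beta> + \<eta> = 0" for \<beta>
    using that by (simp add: eq_neg_iff_add_eq_0)
  have vanish: "vir_poly 0 \<alpha> \<beta> = 0" for \<alpha> \<beta> by simp
  have v1: "shift_divides v" and f1: "\<And>t. shift_quot (s [:t:] v) A = poly_scale s [:[:t:]:] [:v:]"
    and g1: "\<And>t. shift_quot (s [:t:] v) B = poly_scale s 0 [:v:]" if ?c1
  proof -
    have d12: "d1 = 1" "d2 = 0" "\<alpha>1 = 1" "\<beta>1 + \<eta> = 0" using that d by auto
    note A = VA[unfolded d12] and B = VB[unfolded d12]
    show "shift_divides v"
      by (rule shift_divides_generator[OF R span, of "[:v:]" 0]) (simp_all only: A B d12 shift vanish P.scale_zero_left P.scale_zero_right)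
    show "shift_quot (s [:t:] v) A = poly_scale s [:[:t:]:] [:v:]" for t by (rule shift_quot_const[OF A d12(4)])
    show "shift_quot (s [:t:] v) B = poly_scale s 0 [:v:]" for t by (rule shift_quot_vanishing[OF B])
  qed
  have v2: "shift_divides v" and g2: "\<And>t. shift_quot (s [:t:] v) B = poly_scale s [:[:t:]:] [:v:]"
    and f2: "\<And>t. shift_quot (s [:t:] v) A = poly_scale s 0 [:v:]" if ?c2
  proof -
    have d12: "d2 = 1" "d1 = 0" "\<alpha>2 = 1" "\<beta>2 + \<eta> = 0" using that d by auto
    note A = VA[unfolded d12] and B = VB[unfolded d12]
    show "shift_divides v"
      by (rule shift_divides_generator[OF R span, of 0 "[:v:]"]) (simp_all only: A B d12 shift vanish P.scale_zero_left P.scale_zero_right)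
    show "shift_quot (s [:t:] v) B = poly_scale s [:[:t:]:] [:v:]" for t by (rule shift_quot_const[OF B d12(4)])
    show "shift_quot (s [:t:] v) A = poly_scale s 0 [:v:]" for t by (rule shift_quot_vanishing[OF A])
  qed
  \<comment> \<open>Exactly one of the two Virasoro algebras acts nontrivially on \<open>v\<close>, and only it restricts \<open>x\<close>.\<close>
  have condition: "?c1 \<or> ?c2"
    if "extension R V (one_dim \<eta>) E i p" "\<not> trivial_ext V (one_dim \<eta>) E i p"
    for E :: "('r, 'e) cmod" and i p
    using d
  proof
    assume d12: "d1 = 0 \<and> d2 = 1"
    then show ?thesis using nontrivial_condition[OF that, of B \<alpha>2 \<beta>2] VB by simp
  next
    assume d12: "d1 = 1 \<and> d2 = 0"
    then show ?thesis using nontrivial_condition[OF that, of A \<alpha>1 \<beta>1] VA by simp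
  qed
  show ?thesis
    apply (intro conjI impI allI)
    subgoal by (rule standard_form_exists[OF _ VA VB])
    subgoal using condition by blast
    subgoal using ext_dim_one v1 v2 by blast
    subgoal using d by auto
    subgoal by (elim conjE, rule nontrivial_equiv_constant[OF v1 _ _ VA VB f1 g1]) auto
    subgoal by (rule constant_extension_exists[OF v1 _ VA VB f1 g1])
    subgoal using nontrivial_if_constant by blast
    subgoal using d by auto
    subgoal by (elim conjE, rule nontrivial_equiv_constant[OF v2 _ _ VA VB f2 g2]) auto
    subgoal by (rule constant_extension_exists[OF v2 _ VA VB f2 g2])
    subgoal using nontrivial_if_constant by blast
    done
qed

end
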